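(* Let $\mathfrak X$ be any zero-dimensional dense-in-itself metric space. Then $\mathbf{S4DT_1S}$ is complete with respect to $\mathfrak X$; that is, for every bimodal formula $A$, one has $A\in\mathbf{S4DT_1S}$ if and only if $A$ is valid in $\mathfrak X$.
   Context: Formulas are built by $\phi ::= p \mid \bot \mid \phi\to\phi \mid \Box\phi \mid [\neq]\phi$, with $p$ ranging over propositional letters; the other Boolean connectives are the usual abbreviations, $\Diamond A=\neg\Box\neg A$, $\langle\neq\rangle A=\neg[\neq]\neg A$, and $[\forall]A=[\neq]A\wedge A$. A (bimodal) logic is a set of formulas containing all classical tautologies, $\Box(p\to q)\to(\Box p\to\Box q)$ and $[\neq](p\to q)\to([\neq]p\to[\neq]q)$, and closed under Substitution, Modus Ponens, and the two Generalization rules $A/\Box A$ and $A/[\neq]A$. $\mathbf{K_2}$ is the minimal logic, and $L+\Gamma$ is the minimal logic containing the logic $L$ and the set of formulas $\Gamma$. $\mathbf{S4D}=\mathbf{K_2}+\{B_D,4_D^-,D_\Box,T_\Box,4_\Box\}$, $\mathbf{S4DS}=\mathbf{S4D}+DS$, $\mathbf{S4DT_1S}=\mathbf{S4DS}+AT_1$, where $B_D$ is $p\to[\neq]\langle\neq\rangle p$; $4_D^-$ is $(p\wedge[\neq]p)\to[\neq][\neq]p$; $D_\Box$ is $[\forall]p\to\Box p$; $T_\Box$ is $\Box p\to p$; $4_\Box$ is $\Box p\to\Box\Box p$; $DS$ is $[\neq]p\to\Diamond p$; $AT_1$ is $[\neq]p\to[\neq]\Box p$. Topological semantics: a valuation $\theta$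 on a topological space $\mathfrak X$ assigns to each propositional letter a subset of $\mathfrak X$. Truth at a point is defined by: $\mathfrak X,\theta,x\models p$ iff $x\in\theta(p)$; $\bot$ is never true; $\to$ is interpreted classically; $\mathfrak X,\theta,x\models\Box\phi$ iff there is a neighborhood $U$ of $x$ with $\mathfrak X,\theta,y\models\phi$ for all $y\in U$; $\mathfrak X,\theta,x\models[\neq]\phi$ iff $\mathfrak X,\theta,y\models\phi$ for all $y\neq x$. A formula is valid in $\mathfrak X$ if it is true at every point under every valuation. A space is dense-in-itself if it has no isolated points (points $x$ with $\{x\}$ open). A non-empty topological space is zero-dimensional if its clopen sets form a base of its topology. A metric space carries the topology generated by its open balls. *)

theory Defs
  imports "HOL-Analysis.Analysis"
begin

text \<open>
  \<open>DBox\<close> is the difference modality \<open>[\<noteq>]\<close>, \<open>DDia\<close> its dual, and \<open>AllBox\<close> is the universal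
  modality \<open>[\<forall>]\<close>.
\<close>

datatype form =
    Var nat
  | Bot
  | Imp form form  (infixr "\<rightarrow>\<^sub>F" 55)
  | Box form
  | DBox form

definition Neg :: "form \<Rightarrow> form" where "Neg A = (A \<rightarrow>\<^sub>F Bot)"
definition Conj :: "form \<Rightarrow> form \<Rightarrow> form" where "Conj A B = Neg (A \<rightarrow>\<^sub>F Neg B)"
definition Dia :: "form \<Rightarrow> form" where "Dia A = Neg (Box (Neg A))"
definition DDia :: "form \<Rightarrow> form" where "DDia A = Neg (DBox (Neg A))"
definition AllBox :: "form \<Rightarrow> form" where "AllBox A = Conj (DBox A) A"

primrec subst :: "(nat \<Rightarrow> form) \<Rightarrow> form \<Rightarrow> form" where
  "subst s (Var n) = s n"
| "subst s Bot = Bot"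
| "subst s (A \<rightarrow>\<^sub>F B) = (subst s A \<rightarrow>\<^sub>F subst s B)"
| "subst s (Box A) = Box (subst s A)"
| "subst s (DBox A) = DBox (subst s A)"

text \<open>
  Boolean evaluation, in which letters and formulas beginning with a modality are both
  treated as atoms: \<open>v\<close> is consulted on formulas of these two kinds only.
\<close>

primrec bool_eval :: "(form \<Rightarrow> bool) \<Rightarrow> form \<Rightarrow> bool" where
  "bool_eval v (Var n) = v (Var n)"
| "bool_eval v Bot = False"
| "bool_eval v (A \<rightarrow>\<^sub>F B) = (bool_eval v A \<longrightarrow> bool_eval v B)"
| "bool_eval v (Box A) = v (Box A)"
| "bool_eval v (DBox A) = v (DBox A)"

definition tautology :: "form \<Rightarrow> bool" where
  "tautology A \<longleftrightarrow> (\<forall>v. bool_eval v A)"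

abbreviation (input) "letter_p \<equiv> Var 0"
abbreviation (input) "letter_q \<equiv> Var 1"

definition logic :: "form set \<Rightarrow> bool" where
  "logic L \<longleftrightarrow>
     (\<forall>A. tautology A \<longrightarrow> A \<in> L) \<and>
     (Box (letter_p \<rightarrow>\<^sub>F letter_q) \<rightarrow>\<^sub>F (Box letter_p \<rightarrow>\<^sub>F Box letter_q)) \<in> L \<and>
     (DBox (letter_p \<rightarrow>\<^sub>F letter_q) \<rightarrow>\<^sub>F (DBox letter_p \<rightarrow>\<^sub>F DBox letter_q)) \<in> L \<and>
     (\<forall>s. \<forall>A\<in>L. subst s A \<in> L) \<and>
     (\<forall>A B. A \<in> L \<longrightarrow> (A \<rightarrow>\<^sub>F B) \<in> L \<longrightarrow> B \<in> L) \<and>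
     (\<forall>A\<in>L. Box A \<in> L) \<and>
     (\<forall>A\<in>L. DBox A \<in> L)"

text \<open>
  Logics are closed under intersection and \<open>UNIV\<close> is a logic, so the intersections below
  are the minimal logics with the respective properties.
\<close>

definition K2 :: "form set" where
  "K2 = \<Inter>{L. logic L}"

definition ext :: "form set \<Rightarrow> form set \<Rightarrow> form set"  (infixl "+\<^sub>L" 65) where
  "L +\<^sub>L \<Gamma> = \<Inter>{L'. logic L' \<and> L \<subseteq> L' \<and> \<Gamma> \<subseteq> L'}"

definition ax_BD :: form where "ax_BD = (letter_p \<rightarrow>\<^sub>F DBox (DDia letter_p))"
definition ax_4Dm :: form where "ax_4Dm = (Conj letter_p (DBox letter_p) \<rightarrow>\<^sub>F DBox (DBox letter_p))"
definition ax_Dbox :: form where "ax_Dbox = (AllBox letter_p \<rightarrow>\<^sub>F Box letter_p)"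
definition ax_Tbox :: form where "ax_Tbox = (Box letter_p \<rightarrow>\<^sub>F letter_p)"
definition ax_4box :: form where "ax_4box = (Box letter_p \<rightarrow>\<^sub>F Box (Box letter_p))"
definition ax_DS :: form where "ax_DS = (DBox letter_p \<rightarrow>\<^sub>F Dia letter_p)"
definition ax_AT1 :: form where "ax_AT1 = (DBox letter_p \<rightarrow>\<^sub>F DBox (Box letter_p))"

definition S4D :: "form set" where
  "S4D = K2 +\<^sub>L {ax_BD, ax_4Dm, ax_Dbox, ax_Tbox, ax_4box}"

definition S4DS :: "form set" where
  "S4DS = S4D +\<^sub>L {ax_DS}"

definition S4DT1S :: "form set" where
  "S4DT1S = S4DS +\<^sub>L {ax_AT1}"

text \<open>
  A neighbourhood of \<open>x\<close> is a set of points, not necessarily open, having \<open>x\<close> in its interior.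
\<close>

primrec sat :: "'a topology \<Rightarrow> (nat \<Rightarrow> 'a set) \<Rightarrow> 'a \<Rightarrow> form \<Rightarrow> bool" where
  "sat X \<theta> x (Var n) \<longleftrightarrow> x \<in> \<theta> n"
| "sat X \<theta> x Bot \<longleftrightarrow> False"
| "sat X \<theta> x (A \<rightarrow>\<^sub>F B) \<longleftrightarrow> (sat X \<theta> x A \<longrightarrow> sat X \<theta> x B)"
| "sat X \<theta> x (Box A) \<longleftrightarrow> (\<exists>U \<subseteq> topspace X. x \<in> X interior_of U \<and> (\<forall>y\<in>U. sat X \<theta> y A))"
| "sat X \<theta> x (DBox A) \<longleftrightarrow> (\<forall>y \<in> topspace X. y \<noteq> x \<longrightarrow> sat X \<theta> y A)"

definition valid_in :: "'a topology \<Rightarrow> form \<Rightarrow> bool" where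
  "valid_in X A \<longleftrightarrow>
     (\<forall>\<theta>. (\<forall>n. \<theta> n \<subseteq> topspace X) \<longrightarrow> (\<forall>x \<in> topspace X. sat X \<theta> x A))"

definition dense_in_itself :: "'a topology \<Rightarrow> bool" where
  "dense_in_itself X \<longleftrightarrow> \<not> (\<exists>x \<in> topspace X. openin X {x})"

text \<open>
  The second conjunct says that the clopen sets form a base: the open sets are exactly
  the unions of families of clopen sets.
\<close>

definition zero_dimensional :: "'a topology \<Rightarrow> bool" where
  "zero_dimensional X \<longleftrightarrow>
     topspace X \<noteq> {} \<and>
     openin X = arbitrary union_of (\<lambda>U. openin X U \<and> closedin X U)"

end

theory Submission
  imports Defs
begin

text \<open>
  Completeness: filtrating the canonical model through the subformulas of a non-theorem yields a
  finite preorder \<open>(W, R)\<close>, where \<open>DBox\<close> quantifies over all points other than the current one,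
  and over the current one too unless it lies in a set \<open>I\<close> of \<open>R\<close>-minimal points with proper
  successors. It remains to map the space onto \<open>W\<close> by a continuous open map (for the topology of
  upward closed sets of \<open>W\<close>) whose fibre is a singleton over the points of \<open>I\<close> and has at least
  two points elsewhere. Choose a point for each \<open>i \<in> I\<close> and cut a clopen neighbourhood of it into
  clopen annuli, labelled by the proper successors of \<open>i\<close>, each infinitely often. This gives a
  locally constant map off finitely many points. It is then refined in countably many stages: each
  raises the label to some \<open>v \<in> W\<close> in small clopen neighbourhoods of a maximal separated set
  of points at which \<open>v\<close> is above the current label, and fixes the label of these points for
  good. As \<open>W\<close> is finite, the labels of every point are eventually in one cluster, and any label
  that recurs infinitely often serves as the value of the limit map.
\<close>

section \<open>Soundness\<close>

lemma logicD:
  assumes "logic L"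
  shows logic_tautology: "tautology A \<Longrightarrow> A \<in> L"
    and logic_subst: "A \<in> L \<Longrightarrow> subst s A \<in> L"
    and logic_mp: "A \<in> L \<Longrightarrow> (A \<rightarrow>\<^sub>F B) \<in> L \<Longrightarrow> B \<in> L"
    and logic_Box: "A \<in> L \<Longrightarrow> Box A \<in> L"
    and logic_DBox: "A \<in> L \<Longrightarrow> DBox A \<in> L"
  using assms unfolding logic_def by blast+

lemma logic_Inter:
  assumes "\<And>L. L \<in> \<L> \<Longrightarrow> logic L"
  shows "logic (\<Inter>\<L>)"
  unfolding logic_def
proof (intro conjI allI impI ballI InterI)
  show "\<And>A L. tautology A \<Longrightarrow> L \<in> \<L> \<Longrightarrow> A \<in> L"
    using assms by (simp add: logic_def)
  show "\<And>L. L \<in> \<L> \<Longrightarrow> (Box (letter_p \<rightarrow>\<^sub>F letter_q) \<rightarrow>\<^sub>F (Box letter_p \<rightarrow>\<^sub>F Box letter_q)) \<in> L"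
    using assms by (simp add: logic_def)
  show "\<And>L. L \<in> \<L> \<Longrightarrow> (DBox (letter_p \<rightarrow>\<^sub>F letter_q) \<rightarrow>\<^sub>F (DBox letter_p \<rightarrow>\<^sub>F DBox letter_q)) \<in> L"
    using assms by (simp add: logic_def)
  show "\<And>s A L. A \<in> \<Inter>\<L> \<Longrightarrow> L \<in> \<L> \<Longrightarrow> subst s A \<in> L"
    using assms by (simp add: logic_def)
  show "\<And>A B L. A \<in> \<Inter>\<L> \<Longrightarrow> (A \<rightarrow>\<^sub>F B) \<in> \<Inter>\<L> \<Longrightarrow> L \<in> \<L> \<Longrightarrow> B \<in> L"
    using logic_mp[OF assms] by (meson InterE)
  show "\<And>A L. A \<in> \<Inter>\<L> \<Longrightarrow> L \<in> \<L> \<Longrightarrow> Box A \<in> L"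
    using assms by (simp add: logic_def)
  show "\<And>A L. A \<in> \<Inter>\<L> \<Longrightarrow> L \<in> \<L> \<Longrightarrow> DBox A \<in> L"
    using assms by (simp add: logic_def)
qed

lemma logic_ext: "logic (L +\<^sub>L \<Gamma>)"
  unfolding ext_def by (rule logic_Inter) auto

lemma ext_superset: "L \<subseteq> L +\<^sub>L \<Gamma>" "\<Gamma> \<subseteq> L +\<^sub>L \<Gamma>"
  unfolding ext_def by auto

lemma ext_least: "logic L' \<Longrightarrow> L \<subseteq> L' \<Longrightarrow> \<Gamma> \<subseteq> L' \<Longrightarrow> L +\<^sub>L \<Gamma> \<subseteq> L'"
  unfolding ext_def by auto

abbreviation "S4DT1S_axioms \<equiv> {ax_BD, ax_4Dm, ax_Dbox, ax_Tbox, ax_4box, ax_DS, ax_AT1}"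

lemma logic_S4DT1S: "logic S4DT1S"
  unfolding S4DT1S_def by (rule logic_ext)

lemma S4DT1S_axioms_subset: "S4DT1S_axioms \<subseteq> S4DT1S"
proof -
  have "S4D \<subseteq> S4DS" "S4DS \<subseteq> S4DT1S"
    unfolding S4DS_def S4DT1S_def by (rule ext_superset)+
  moreover have "{ax_BD, ax_4Dm, ax_Dbox, ax_Tbox, ax_4box} \<subseteq> S4D" "{ax_DS} \<subseteq> S4DS" "{ax_AT1} \<subseteq> S4DT1S"
    unfolding S4D_def S4DS_def S4DT1S_def by (rule ext_superset)+
  ultimately show ?thesis by auto
qed

text \<open>Takes the place of an induction on derivations: soundness follows once the validities of
  a space form a logic that contains the seven axioms. The bound passes through the nested
  extensions one by one.\<close>

lemma S4DT1S_least:
  assumes "logic L" "S4DT1S_axioms \<subseteq> L"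
  shows "S4DT1S \<subseteq> L"
  unfolding S4DT1S_def S4DS_def S4D_def K2_def using assms
  by (intro ext_least Inter_lower) auto

section \<open>Truth and validity in topological spaces\<close>

lemma sat_Neg [simp]: "sat X \<theta> x (Neg A) \<longleftrightarrow> \<not> sat X \<theta> x A"
  and sat_Conj [simp]: "sat X \<theta> x (Conj A B) \<longleftrightarrow> sat X \<theta> x A \<and> sat X \<theta> x B"
  and sat_DDia [simp]:
    "sat X \<theta> x (DDia A) \<longleftrightarrow> (\<exists>y\<in>topspace X. y \<noteq> x \<and> sat X \<theta> y A)"
  by (auto simp: Neg_def Conj_def DDia_def)

lemma sat_AllBox:
  "x \<in> topspace X \<Longrightarrow> sat X \<theta> x (AllBox A) \<longleftrightarrow> (\<forall>y\<in>topspace X. sat X \<theta> y A)"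
  by (auto simp: AllBox_def)

lemma sat_Box_openin:
  "sat X \<theta> x (Box A) \<longleftrightarrow> (\<exists>U. openin X U \<and> x \<in> U \<and> (\<forall>y\<in>U. sat X \<theta> y A))"
proof
  assume "sat X \<theta> x (Box A)"
  then obtain U where "x \<in> X interior_of U" "\<forall>y\<in>U. sat X \<theta> y A" by auto
  then show "\<exists>U. openin X U \<and> x \<in> U \<and> (\<forall>y\<in>U. sat X \<theta> y A)"
    by (meson interior_of_subset openin_interior_of subsetD)
next
  assume "\<exists>U. openin X U \<and> x \<in> U \<and> (\<forall>y\<in>U. sat X \<theta> y A)"
  then obtain U where "openin X U" "x \<in> U" "\<forall>y\<in>U. sat X \<theta> y A" by blast
  then show "sat X \<theta> x (Box A)"
    unfolding sat.simps(4) by (intro exI[of _ U]) (simp add: interior_of_openin openin_subset)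
qed

lemma sat_Dia_openin:
  "sat X \<theta> x (Dia A) \<longleftrightarrow> (\<forall>U. openin X U \<longrightarrow> x \<in> U \<longrightarrow> (\<exists>y\<in>U. sat X \<theta> y A))"
  unfolding Dia_def sat_Neg sat_Box_openin by blast

text \<open>Yields closure of the validities under Substitution. The truth set of \<open>s n\<close>
  is cut down to the space because valuations take their values there.\<close>

lemma sat_subst:
  assumes "x \<in> topspace X"
  shows "sat X \<theta> x (subst s A) \<longleftrightarrow> sat X (\<lambda>n. {y\<in>topspace X. sat X \<theta> y (s n)}) x A"
  using assms
proof (induction A arbitrary: x)
  case (Box A)
  then have "(\<forall>y\<in>U. sat X \<theta> y (subst s A)) \<longleftrightarrow>
      (\<forall>y\<in>U. sat X (\<lambda>n. {y\<in>topspace X. sat X \<theta> y (s n)}) y A)" if "openin X U" for U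
    using openin_subset[OF that] by blast
  then show ?case
    by (auto simp: sat_Box_openin simp del: sat.simps(4))
qed auto

lemma sat_tautology:
  assumes "tautology A"
  shows "sat X \<theta> x A"
proof -
  \<comment> \<open>Truth at a fixed point is itself a Boolean evaluation with letters and modal
    formulas as atoms.\<close>
  have "bool_eval (\<lambda>B. sat X \<theta> x B) A = sat X \<theta> x A"
    by (induction A) auto
  then show ?thesis using assms by (simp add: tautology_def)
qed

lemma logic_valid_in: "logic {A. valid_in X A}"
  unfolding logic_def
proof (intro conjI allI impI ballI; unfold mem_Collect_eq valid_in_def)
  show "\<And>A. tautology A \<Longrightarrow> \<forall>\<theta>. (\<forall>n. \<theta> n \<subseteq> topspace X) \<longrightarrow> (\<forall>x\<in>topspace X. sat X \<theta> x A)"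
    by (simp add: sat_tautology)
  have "sat X \<theta> x (Box B)" if "sat X \<theta> x (Box (A \<rightarrow>\<^sub>F B))" "sat X \<theta> x (Box A)" for \<theta> x A B
  proof -
    obtain U V where "openin X U" "x \<in> U" "\<forall>y\<in>U. sat X \<theta> y (A \<rightarrow>\<^sub>F B)"
      and "openin X V" "x \<in> V" "\<forall>y\<in>V. sat X \<theta> y A"
      using \<open>sat X \<theta> x (Box (A \<rightarrow>\<^sub>F B))\<close> \<open>sat X \<theta> x (Box A)\<close> by (auto simp: sat_Box_openin simp del: sat.simps(4))
    then have "openin X (U \<inter> V)" "x \<in> U \<inter> V" "\<forall>y\<in>U \<inter> V. sat X \<theta> y B" by auto
    then show ?thesis unfolding sat_Box_openin by blast
  qed
  then show "\<forall>\<theta>. (\<forall>n. \<theta> n \<subseteq> topspace X) \<longrightarrow> (\<forall>x\<in>topspace X. sat X \<theta> x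
      (Box (letter_p \<rightarrow>\<^sub>F letter_q) \<rightarrow>\<^sub>F (Box letter_p \<rightarrow>\<^sub>F Box letter_q)))"
    by (simp del: sat.simps(4))
  show "\<forall>\<theta>. (\<forall>n. \<theta> n \<subseteq> topspace X) \<longrightarrow> (\<forall>x\<in>topspace X. sat X \<theta> x
      (DBox (letter_p \<rightarrow>\<^sub>F letter_q) \<rightarrow>\<^sub>F (DBox letter_p \<rightarrow>\<^sub>F DBox letter_q)))"
    by simp
next
  fix s A
  assume A: "\<forall>\<theta>. (\<forall>n. \<theta> n \<subseteq> topspace X) \<longrightarrow> (\<forall>x\<in>topspace X. sat X \<theta> x A)"
  show "\<forall>\<theta>. (\<forall>n. \<theta> n \<subseteq> topspace X) \<longrightarrow> (\<forall>x\<in>topspace X. sat X \<theta> x (subst s A))"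
  proof (intro allI impI ballI)
    fix \<theta> x assume "x \<in> topspace X"
    then show "sat X \<theta> x (subst s A)"
      using A by (simp add: sat_subst Collect_restrict)
  qed
next
  fix A
  assume A: "\<forall>\<theta>. (\<forall>n. \<theta> n \<subseteq> topspace X) \<longrightarrow> (\<forall>x\<in>topspace X. sat X \<theta> x A)"
  show "\<forall>\<theta>. (\<forall>n. \<theta> n \<subseteq> topspace X) \<longrightarrow> (\<forall>x\<in>topspace X. sat X \<theta> x (Box A))"
    using A openin_topspace[of X] unfolding sat_Box_openin by blast
qed auto

text \<open>The axioms of \<open>S4D\<close> hold in every space. \<open>ax_DS\<close> holds because
  no neighbourhood of \<open>x\<close> reduces to \<open>x\<close>; \<open>ax_AT1\<close> because in
  a T1 space the complement of \<open>x\<close> is open, hence a neighbourhood of each other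
  point.\<close>

lemma S4DT1S_sound:
  assumes "t1_space X" "dense_in_itself X" "A \<in> S4DT1S"
  shows "valid_in X A"
proof -
  have "valid_in X A" if A: "A \<in> S4DT1S_axioms" for A
    unfolding valid_in_def
  proof (intro allI impI ballI)
    fix \<theta> x assume x: "x \<in> topspace X"
    have BD: "sat X \<theta> x ax_BD" using x unfolding ax_BD_def sat.simps sat_DDia by metis
    have 4: "sat X \<theta> x ax_4Dm" by (auto simp: ax_4Dm_def)
    have D: "sat X \<theta> x ax_Dbox"
      using x openin_topspace[of X]
      by (auto simp: ax_Dbox_def sat_AllBox sat_Box_openin simp del: sat.simps(4) openin_topspace)
    have T: "sat X \<theta> x ax_Tbox" by (auto simp: ax_Tbox_def sat_Box_openin simp del: sat.simps(4))
    have 44: "sat X \<theta> x ax_4box"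
      unfolding ax_4box_def sat.simps(3) sat_Box_openin by blast
    have DS: "sat X \<theta> x ax_DS"
    proof -
      have "\<exists>y\<in>U. y \<in> topspace X \<and> y \<noteq> x" if "openin X U" "x \<in> U" for U
        using \<open>dense_in_itself X\<close> that x openin_subset[OF that(1)] unfolding dense_in_itself_def
        by (metis insert_absorb insert_ident insert_subset singletonI subsetI subset_singleton_iff subsetD)
      then show ?thesis unfolding ax_DS_def sat.simps(3,5) sat_Dia_openin by blast
    qed
    have AT: "sat X \<theta> x ax_AT1"
    proof -
      have "openin X (topspace X - {x})"
        using \<open>t1_space X\<close> x by (simp add: t1_space_openin_delete_alt)
      then have "sat X \<theta> y (Box letter_p)"
        if "sat X \<theta> x (DBox letter_p)" "y \<in> topspace X" "y \<noteq> x" for y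
        using that unfolding sat_Box_openin by fastforce
      then show ?thesis by (simp add: ax_AT1_def del: sat.simps(4))
    qed
    show "sat X \<theta> x A" using A BD 4 D T 44 DS AT by blast
  qed
  then have "S4DT1S_axioms \<subseteq> {A. valid_in X A}" by blast
  then show ?thesis
    using S4DT1S_least[OF logic_valid_in] \<open>A \<in> S4DT1S\<close> by blast
qed

section \<open>Canonical model\<close>

text \<open>Closure under the Generalization rules is not imposed: a theory collects what holds at a
  single world.\<close>

definition closed_theory :: "form set \<Rightarrow> form set \<Rightarrow> bool" where
  "closed_theory L T \<longleftrightarrow> L \<subseteq> T \<and> (\<forall>A B. A \<in> T \<longrightarrow> (A \<rightarrow>\<^sub>F B) \<in> T \<longrightarrow> B \<in> T)"

text \<open>Maximal consistent sets, the worlds of the canonical model, with maximality expressed as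
  negation completeness.\<close>

definition mcs :: "form set \<Rightarrow> form set \<Rightarrow> bool" where
  "mcs L T \<longleftrightarrow> closed_theory L T \<and> Bot \<notin> T \<and> (\<forall>A. A \<in> T \<or> Neg A \<in> T)"

lemma logic_K:
  assumes "logic L"
  shows "(Box (A \<rightarrow>\<^sub>F B) \<rightarrow>\<^sub>F (Box A \<rightarrow>\<^sub>F Box B)) \<in> L"
    and "(DBox (A \<rightarrow>\<^sub>F B) \<rightarrow>\<^sub>F (DBox A \<rightarrow>\<^sub>F DBox B)) \<in> L"
proof -
  let ?s = "\<lambda>n. if n = 0 then A else B"
  have "(Box (letter_p \<rightarrow>\<^sub>F letter_q) \<rightarrow>\<^sub>F (Box letter_p \<rightarrow>\<^sub>F Box letter_q)) \<in> L"
    "(DBox (letter_p \<rightarrow>\<^sub>F letter_q) \<rightarrow>\<^sub>F (DBox letter_p \<rightarrow>\<^sub>F DBox letter_q)) \<in> L"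
    using assms unfolding logic_def by blast+
  from this[THEN logic_subst[OF assms, where s = ?s]]
  show "(Box (A \<rightarrow>\<^sub>F B) \<rightarrow>\<^sub>F (Box A \<rightarrow>\<^sub>F Box B)) \<in> L"
    and "(DBox (A \<rightarrow>\<^sub>F B) \<rightarrow>\<^sub>F (DBox A \<rightarrow>\<^sub>F DBox B)) \<in> L"
    by simp_all
qed

lemma theory_mp: "closed_theory L T \<Longrightarrow> (A \<rightarrow>\<^sub>F B) \<in> T \<Longrightarrow> A \<in> T \<Longrightarrow> B \<in> T"
  unfolding closed_theory_def by blast

lemma theory_logic: "closed_theory L T \<Longrightarrow> A \<in> L \<Longrightarrow> A \<in> T"
  unfolding closed_theory_def by blast

lemma theory_tautology: "logic L \<Longrightarrow> closed_theory L T \<Longrightarrow> tautology A \<Longrightarrow> A \<in> T"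
  by (simp add: logic_tautology theory_logic)

lemma closed_theory_logic: "logic L \<Longrightarrow> closed_theory L L"
  unfolding closed_theory_def by (blast intro: logic_mp)

text \<open>The deduction theorem: this set is the theory generated by \<open>T\<close> and
  \<open>B\<close>.\<close>

lemma closed_theory_Imp:
  assumes L: "logic L" and T: "closed_theory L T"
  shows "closed_theory L {C. (B \<rightarrow>\<^sub>F C) \<in> T}"
  unfolding closed_theory_def
proof (intro conjI allI impI subsetI; unfold mem_Collect_eq)
  fix C assume "C \<in> L"
  have "(C \<rightarrow>\<^sub>F (B \<rightarrow>\<^sub>F C)) \<in> T"
    by (rule theory_tautology[OF L T]) (simp add: tautology_def)
  then show "(B \<rightarrow>\<^sub>F C) \<in> T" using theory_mp[OF T] theory_logic[OF T \<open>C \<in> L\<close>] by blast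
next
  fix C D assume "(B \<rightarrow>\<^sub>F C) \<in> T" "(B \<rightarrow>\<^sub>F (C \<rightarrow>\<^sub>F D)) \<in> T"
  moreover have "((B \<rightarrow>\<^sub>F C) \<rightarrow>\<^sub>F ((B \<rightarrow>\<^sub>F (C \<rightarrow>\<^sub>F D)) \<rightarrow>\<^sub>F (B \<rightarrow>\<^sub>F D))) \<in> T"
    by (rule theory_tautology[OF L T]) (simp add: tautology_def)
  ultimately show "(B \<rightarrow>\<^sub>F D) \<in> T" using theory_mp[OF T] by blast
qed

text \<open>Zorn's lemma gives a theory maximal among those that extend \<open>T\<close> and omit
  \<open>A\<close>. It is negation complete: every formula outside it implies \<open>A\<close> in
  it, so if \<open>B\<close> and \<open>Neg B\<close> were both outside, \<open>A\<close> would
  follow by cases.\<close>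

lemma Lindenbaum:
  assumes L: "logic L" and T: "closed_theory L T" and A: "A \<notin> T"
  obtains M where "mcs L M" "T \<subseteq> M" "A \<notin> M"
proof -
  let ?\<A> = "{M. closed_theory L M \<and> T \<subseteq> M \<and> A \<notin> M}"
  have Un: "\<Union>\<C> \<in> ?\<A>" if \<C>: "\<C> \<noteq> {}" "subset.chain ?\<A> \<C>" for \<C>
  proof -
    have chain: "X \<in> ?\<A>" "X \<subseteq> Y \<or> Y \<subseteq> X" if "X \<in> \<C>" "Y \<in> \<C>" for X Y
      using \<C>(2) that unfolding subset_chain_def by blast+
    have "closed_theory L (\<Union>\<C>)"
      unfolding closed_theory_def
    proof (intro conjI allI impI)
      obtain X where "X \<in> \<C>" using \<C>(1) by blast
      then show "L \<subseteq> \<Union>\<C>" using chain(1)[of X X] by (auto simp: closed_theory_def)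
    next
      fix B C assume "B \<in> \<Union>\<C>" "(B \<rightarrow>\<^sub>F C) \<in> \<Union>\<C>"
      then obtain X where "X \<in> \<C>" "B \<in> X" "(B \<rightarrow>\<^sub>F C) \<in> X" using chain(2) by blast
      then show "C \<in> \<Union>\<C>" using chain(1)[of X X] theory_mp[of L X B C] by blast
    qed
    moreover have "T \<subseteq> \<Union>\<C>"
    proof -
      obtain X where "X \<in> \<C>" using \<C>(1) by blast
      then show ?thesis using chain(1)[of X X] by auto
    qed
    moreover have "A \<notin> \<Union>\<C>"
    proof
      assume "A \<in> \<Union>\<C>"
      then obtain X where "X \<in> \<C>" "A \<in> X" by (rule UnionE)
      then show False using chain(1)[of X X] by simp
    qed
    ultimately show ?thesis by simp
  qed
  have "?\<A> \<noteq> {}" using T A by blast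
  from subset_Zorn_nonempty[OF this Un]
  obtain M where "M \<in> ?\<A>" and max: "\<forall>X\<in>?\<A>. M \<subseteq> X \<longrightarrow> X = M"
    by (rule bexE)
  then have M: "closed_theory L M" "T \<subseteq> M" "A \<notin> M" by simp_all
  note taut = theory_tautology[OF L M(1)] and mp = theory_mp[OF M(1)]
  \<comment> \<open>Otherwise the theory generated by \<open>M\<close> and \<open>B\<close> would
    still omit \<open>A\<close>, although it is strictly larger than \<open>M\<close>.\<close>
  have *: "(B \<rightarrow>\<^sub>F A) \<in> M" if "B \<notin> M" for B
  proof (rule ccontr)
    assume "(B \<rightarrow>\<^sub>F A) \<notin> M"
    let ?X = "{C. (B \<rightarrow>\<^sub>F C) \<in> M}"
    have "(C \<rightarrow>\<^sub>F (B \<rightarrow>\<^sub>F C)) \<in> M" for C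
      by (rule taut) (simp add: tautology_def)
    then have "M \<subseteq> ?X" using mp by blast
    moreover from this have "?X \<in> ?\<A>"
      using \<open>(B \<rightarrow>\<^sub>F A) \<notin> M\<close> M(2) closed_theory_Imp[OF L M(1)] by auto
    ultimately have "?X = M" using max by blast
    moreover have "(B \<rightarrow>\<^sub>F B) \<in> M" by (rule taut) (simp add: tautology_def)
    ultimately show False using that by blast
  qed
  have "B \<in> M \<or> Neg B \<in> M" for B
  proof (rule ccontr)
    assume "\<not> (B \<in> M \<or> Neg B \<in> M)"
    then have "(B \<rightarrow>\<^sub>F A) \<in> M" "(Neg B \<rightarrow>\<^sub>F A) \<in> M" using * by blast+
    moreover have "((B \<rightarrow>\<^sub>F A) \<rightarrow>\<^sub>F ((Neg B \<rightarrow>\<^sub>F A) \<rightarrow>\<^sub>F A)) \<in> M"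
      by (rule taut) (auto simp: tautology_def Neg_def)
    ultimately show False using mp M(3) by blast
  qed
  moreover have "Bot \<notin> M"
  proof
    assume "Bot \<in> M"
    moreover have "(Bot \<rightarrow>\<^sub>F A) \<in> M" by (rule taut) (simp add: tautology_def)
    ultimately show False using mp M(3) by blast
  qed
  ultimately show thesis using M that unfolding mcs_def by blast
qed

lemma mcs_theory: "mcs L M \<Longrightarrow> closed_theory L M"
  by (simp add: mcs_def)

lemma mcs_Bot: "mcs L M \<Longrightarrow> Bot \<notin> M"
  by (simp add: mcs_def)

lemma mcs_Neg: "mcs L M \<Longrightarrow> Neg A \<in> M \<longleftrightarrow> A \<notin> M"
  unfolding mcs_def Neg_def using theory_mp by blast

lemma mcs_Imp:
  assumes L: "logic L" and M: "mcs L M"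
  shows "(A \<rightarrow>\<^sub>F B) \<in> M \<longleftrightarrow> (A \<in> M \<longrightarrow> B \<in> M)"
proof -
  note mp = theory_mp[OF mcs_theory[OF M]] and taut = theory_tautology[OF L mcs_theory[OF M]]
  have "(B \<rightarrow>\<^sub>F (A \<rightarrow>\<^sub>F B)) \<in> M" "(Neg A \<rightarrow>\<^sub>F (A \<rightarrow>\<^sub>F B)) \<in> M"
    by (rule taut; simp add: tautology_def Neg_def)+
  then show ?thesis using mp mcs_Neg[OF M] by blast
qed

lemma mcs_Conj:
  assumes "logic L" "mcs L M"
  shows "Conj A B \<in> M \<longleftrightarrow> A \<in> M \<and> B \<in> M"
  unfolding Conj_def by (simp add: mcs_Neg[OF assms(2)] mcs_Imp[OF assms])

section \<open>Canonical accessibility relations\<close>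

lemma closed_theory_Box:
  assumes L: "logic L" and M: "closed_theory L M"
  shows "closed_theory L {C. Box C \<in> M}" "closed_theory L {C. DBox C \<in> M}"
  unfolding closed_theory_def
  using theory_mp[OF M] theory_logic[OF M] logic_K[OF L] logic_Box[OF L] logic_DBox[OF L] by blast+

definition acc :: "(form \<Rightarrow> form) \<Rightarrow> form set \<Rightarrow> form set \<Rightarrow> bool" where
  "acc b M N \<longleftrightarrow> (\<forall>C. b C \<in> M \<longrightarrow> C \<in> N)"

lemma accD: "acc b M N \<Longrightarrow> b C \<in> M \<Longrightarrow> C \<in> N"
  by (simp add: acc_def)

text \<open>The existence lemma of canonical models, for both modalities at once: the formulas boxed
  in \<open>M\<close> form a theory, and a formula outside this theory is omitted by some maximal
  consistent extension of it.\<close>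

lemma mcs_acc:
  assumes L: "logic L" and M: "mcs L M" and b: "b = Box \<or> b = DBox"
  shows "b A \<in> M \<longleftrightarrow> (\<forall>N. mcs L N \<longrightarrow> acc b M N \<longrightarrow> A \<in> N)"
proof (intro iffI allI impI)
  assume *: "\<forall>N. mcs L N \<longrightarrow> acc b M N \<longrightarrow> A \<in> N"
  show "b A \<in> M"
  proof (rule ccontr)
    assume "b A \<notin> M"
    moreover have "closed_theory L {C. b C \<in> M}"
      using b closed_theory_Box[OF L mcs_theory[OF M]] by blast
    ultimately obtain N where "mcs L N" "{C. b C \<in> M} \<subseteq> N" "A \<notin> N"
      using Lindenbaum[OF L, of "{C. b C \<in> M}" A] by blast
    then show False using * by (auto simp: acc_def)
  qed
qed (simp add: accD)

text \<open>Distinct worlds are therefore separated by a formula true in the first and false in the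
  second; the arguments for \<open>ax_4Dm\<close> and \<open>ax_Dbox\<close> rest on such a formula
  \<open>q\<close>.\<close>

lemma mcs_subset_eq: "mcs L M \<Longrightarrow> mcs L N \<Longrightarrow> M \<subseteq> N \<Longrightarrow> M = N"
  using mcs_Neg by blast

context
  fixes L assumes L: "logic L"
begin

text \<open>Each axiom contains a single letter, so a constant substitution produces every
  instance.\<close>

lemma mcs_instance:
  assumes "ax \<in> L" "mcs L M"
  shows "subst (\<lambda>_. A) ax \<in> M"
  using assms logic_subst[OF L] theory_logic mcs_theory by blast

lemma acc_Box_refl:
  assumes "ax_Tbox \<in> L" "mcs L M" shows "acc Box M M"
  using mcs_instance[OF assms] by (simp add: acc_def ax_Tbox_def mcs_Imp[OF L assms(2)])

lemma mcs_4box: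
  assumes "ax_4box \<in> L" "mcs L M" "Box A \<in> M" shows "Box (Box A) \<in> M"
  using mcs_instance[OF assms(1,2), of A] assms(3) by (simp add: ax_4box_def mcs_Imp[OF L assms(2)])

lemma acc_DBox_sym:
  assumes "ax_BD \<in> L" "mcs L M" "mcs L N" "acc DBox M N" shows "acc DBox N M"
  unfolding acc_def
proof (intro allI impI)
  fix C assume "DBox C \<in> N"
  show "C \<in> M"
  proof (rule ccontr)
    assume "C \<notin> M"
    \<comment> \<open>\<open>ax_BD\<close> for \<open>Neg C\<close>: \<open>M\<close> contains
      \<open>DBox (DDia (Neg C))\<close>, so \<open>N\<close> contains \<open>DDia (Neg C)\<close>,
      which conflicts with \<open>DBox C\<close>.\<close>
    then have "DBox (Neg (DBox (Neg (Neg C)))) \<in> M"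
      using mcs_instance[OF assms(1,2), of "Neg C"]
      by (simp add: ax_BD_def mcs_Imp[OF L assms(2)] mcs_Neg[OF assms(2)] DDia_def Neg_def)
    then have "DBox (Neg (Neg C)) \<notin> N"
      using accD[OF assms(4)] mcs_Neg[OF assms(3)] by blast
    moreover have "DBox (Neg (Neg C)) \<in> N"
    proof -
      have "(C \<rightarrow>\<^sub>F Neg (Neg C)) \<in> L"
        by (rule logic_tautology[OF L]) (simp add: tautology_def Neg_def)
      then show ?thesis
        using \<open>DBox C \<in> N\<close> mcs_theory[OF assms(3)]
        by (meson L logic_DBox logic_K(2) theory_logic theory_mp)
    qed
    ultimately show False by blast
  qed
qed

lemma mcs_mono:
  assumes "mcs L M" "tautology (A \<rightarrow>\<^sub>F B)" "DBox A \<in> M"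
  shows "DBox B \<in> M"
  using assms mcs_theory[OF assms(1)]
  by (meson L logic_DBox logic_K(2) logic_tautology theory_logic theory_mp)

text \<open>If \<open>M \<noteq> N\<close>, some \<open>q\<close> lies in \<open>M\<close> but not in \<open>N\<close>, and \<open>DBox C \<in> M\<close> yields
  \<open>AllBox (q \<or> C) \<in> M\<close>.\<close>

lemma acc_DBox_trans:
  assumes "ax_4Dm \<in> L" "mcs L M" "mcs L N" "mcs L K" "acc DBox M N" "acc DBox N K" "M \<noteq> K"
  shows "acc DBox M K"
  unfolding acc_def
proof (intro allI impI)
  fix C assume C: "DBox C \<in> M"
  obtain q where q: "q \<in> M" "q \<notin> K" using mcs_subset_eq[OF assms(2,4)] \<open>M \<noteq> K\<close> by blast
  let ?D = "Neg q \<rightarrow>\<^sub>F C"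
  have "?D \<in> M" using q by (simp add: mcs_Imp[OF L assms(2)] mcs_Neg[OF assms(2)])
  moreover have "DBox ?D \<in> M"
    by (rule mcs_mono[OF assms(2) _ C]) (simp add: tautology_def)
  ultimately have "DBox (DBox ?D) \<in> M"
    using mcs_instance[OF assms(1,2), of ?D]
    by (simp add: ax_4Dm_def mcs_Imp[OF L assms(2)] mcs_Conj[OF L assms(2)]
        Neg_def Conj_def)
  then have "?D \<in> K" using accD assms(5,6) by blast
  then show "C \<in> K" using q by (simp add: mcs_Imp[OF L assms(4)] mcs_Neg[OF assms(4)])
qed

text \<open>The separating formula works as in \<open>acc_DBox_trans\<close>: \<open>DBox C\<close>
  at \<open>M\<close> becomes \<open>AllBox\<close> of "\<open>q\<close> or \<open>C\<close>", hence
  \<open>Box\<close> of it by \<open>ax_Dbox\<close>, and at \<open>N\<close> only \<open>C\<close>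
  can be the true disjunct.\<close>

lemma acc_Box_imp_DBox:
  assumes "ax_Dbox \<in> L" "mcs L M" "mcs L N" "acc Box M N" "M \<noteq> N"
  shows "acc DBox M N"
  unfolding acc_def
proof (intro allI impI)
  fix C assume C: "DBox C \<in> M"
  obtain q where q: "q \<in> M" "q \<notin> N" using mcs_subset_eq[OF assms(2,3)] \<open>M \<noteq> N\<close> by blast
  let ?D = "Neg q \<rightarrow>\<^sub>F C"
  have "?D \<in> M" using q by (simp add: mcs_Imp[OF L assms(2)] mcs_Neg[OF assms(2)])
  moreover have "DBox ?D \<in> M"
    by (rule mcs_mono[OF assms(2) _ C]) (simp add: tautology_def)
  ultimately have "Box ?D \<in> M"
    using mcs_instance[OF assms(1,2), of ?D]
    by (simp add: ax_Dbox_def AllBox_def mcs_Imp[OF L assms(2)] Neg_def Conj_def mcs_Bot[OF assms(2)])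
  then have "?D \<in> N" using accD assms(4) by blast
  then show "C \<in> N" using q by (simp add: mcs_Imp[OF L assms(3)] mcs_Neg[OF assms(3)])
qed

text \<open>With \<open>K = M\<close>: a world that is a \<open>Box\<close>-successor of one of its
  own \<open>DBox\<close>-successors is \<open>DBox\<close>-reflexive. This will make the
  irreflexive worlds minimal.\<close>

lemma acc_AT1:
  assumes "ax_AT1 \<in> L" "mcs L M" "acc DBox M N" "acc Box N K"
  shows "acc DBox M K"
  unfolding acc_def
proof (intro allI impI)
  fix C assume "DBox C \<in> M"
  then have "DBox (Box C) \<in> M"
    using mcs_instance[OF assms(1,2), of C] by (simp add: ax_AT1_def mcs_Imp[OF L assms(2)])
  then show "C \<in> K" using accD assms(3,4) by blast
qed

text \<open>The formulas boxed in \<open>M\<close> by either modality are jointly consistent: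
  otherwise \<open>M\<close> contains \<open>DBox D\<close> and \<open>Box (Neg D)\<close> for some
  \<open>D\<close>, against \<open>ax_DS\<close>.\<close>

lemma acc_DS:
  assumes "ax_DS \<in> L" "mcs L M"
  obtains N where "mcs L N" "acc Box M N" "acc DBox M N"
proof -
  note th = mcs_theory[OF assms(2)]
  note mp = theory_mp[OF th]
  have K: "Box B \<in> M" if "(A \<rightarrow>\<^sub>F B) \<in> L" "Box A \<in> M" for A B
    using that th by (meson L logic_Box logic_K(1) theory_logic theory_mp)
  have KD: "DBox B \<in> M" if "(A \<rightarrow>\<^sub>F B) \<in> L" "DBox A \<in> M" for A B
    using that th by (meson L logic_DBox logic_K(2) theory_logic theory_mp)
  have K2: "Box B \<in> M" if "Box (A \<rightarrow>\<^sub>F B) \<in> M" "Box A \<in> M" for A B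
    using that th by (meson L logic_K(1) theory_logic theory_mp)
  have KD2: "DBox B \<in> M" if "DBox (A \<rightarrow>\<^sub>F B) \<in> M" "DBox A \<in> M" for A B
    using that th by (meson L logic_K(2) theory_logic theory_mp)
  \<comment> \<open>The theory generated by both kinds of boxed formulas. One premise
    \<open>D\<close> of the \<open>DBox\<close> kind is enough, since these are closed under
    conjunction.\<close>
  let ?T = "{C. \<exists>D. DBox D \<in> M \<and> Box (D \<rightarrow>\<^sub>F C) \<in> M}"
  let ?top = "Bot \<rightarrow>\<^sub>F Bot"
  have top: "DBox ?top \<in> M"
    by (intro theory_logic[OF th] logic_DBox[OF L] logic_tautology[OF L]) (simp add: tautology_def)
  have Box: "{C. Box C \<in> M} \<subseteq> ?T"
  proof
    fix C assume "C \<in> {C. Box C \<in> M}"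
    moreover have "(C \<rightarrow>\<^sub>F (?top \<rightarrow>\<^sub>F C)) \<in> L"
      by (rule logic_tautology[OF L]) (simp add: tautology_def)
    ultimately show "C \<in> ?T" using top K by blast
  qed
  have DBox: "{C. DBox C \<in> M} \<subseteq> ?T"
  proof -
    have "Box (C \<rightarrow>\<^sub>F C) \<in> M" for C
      by (intro theory_logic[OF th] logic_Box[OF L] logic_tautology[OF L]) (simp add: tautology_def)
    then show ?thesis by blast
  qed
  have "closed_theory L ?T"
    unfolding closed_theory_def
  proof (intro conjI allI impI)
    have "L \<subseteq> {C. Box C \<in> M}" using theory_logic[OF th] logic_Box[OF L] by blast
    then show "L \<subseteq> ?T" using Box by (rule subset_trans)
  next
    fix A B assume "A \<in> ?T" "(A \<rightarrow>\<^sub>F B) \<in> ?T"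
    then obtain D E where D: "DBox D \<in> M" "Box (D \<rightarrow>\<^sub>F A) \<in> M"
      and E: "DBox E \<in> M" "Box (E \<rightarrow>\<^sub>F (A \<rightarrow>\<^sub>F B)) \<in> M" by blast
    have "(D \<rightarrow>\<^sub>F (E \<rightarrow>\<^sub>F Conj D E)) \<in> L"
      by (rule logic_tautology[OF L]) (simp add: tautology_def Conj_def Neg_def)
    then have "DBox (Conj D E) \<in> M" using KD KD2 D(1) E(1) by blast
    moreover have "((D \<rightarrow>\<^sub>F A) \<rightarrow>\<^sub>F ((E \<rightarrow>\<^sub>F (A \<rightarrow>\<^sub>F B)) \<rightarrow>\<^sub>F (Conj D E \<rightarrow>\<^sub>F B))) \<in> L"
      by (rule logic_tautology[OF L]) (simp add: tautology_def Conj_def Neg_def)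
    then have "Box (Conj D E \<rightarrow>\<^sub>F B) \<in> M" using K K2 D(2) E(2) by blast
    ultimately show "B \<in> ?T" by blast
  qed
  moreover have "Bot \<notin> ?T"
  proof
    assume "Bot \<in> ?T"
    then obtain D where "DBox D \<in> M" "Box (Neg D) \<in> M" by (auto simp: Neg_def)
    then show False
      using mcs_instance[OF assms, of D] mcs_Bot[OF assms(2)]
      by (simp add: ax_DS_def Dia_def mcs_Imp[OF L assms(2)] Neg_def)
  qed
  ultimately obtain N where "mcs L N" "?T \<subseteq> N" by (rule Lindenbaum[OF L])
  then have "acc Box M N" "acc DBox M N"
    using Box DBox unfolding acc_def by (meson CollectI subsetD)+
  with \<open>mcs L N\<close> show thesis by (rule that)
qed

end

section \<open>Finite model property\<close>

primrec subformulas :: "form \<Rightarrow> form set" where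
  "subformulas (Var n) = {Var n}"
| "subformulas Bot = {Bot}"
| "subformulas (A \<rightarrow>\<^sub>F B) = insert (A \<rightarrow>\<^sub>F B) (subformulas A \<union> subformulas B)"
| "subformulas (Box A) = insert (Box A) (subformulas A)"
| "subformulas (DBox A) = insert (DBox A) (subformulas A)"

lemma finite_subformulas: "finite (subformulas A)"
  by (induction A) auto

lemma subformulas_self: "A \<in> subformulas A"
  by (cases A) auto

lemma subformulas_trans: "B \<in> subformulas A \<Longrightarrow> subformulas B \<subseteq> subformulas A"
  by (induction A) auto

lemma subformulas_closed:
  shows "(B \<rightarrow>\<^sub>F C) \<in> subformulas A \<Longrightarrow> B \<in> subformulas A"
    and "(B \<rightarrow>\<^sub>F C) \<in> subformulas A \<Longrightarrow> C \<in> subformulas A"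
    and "Box B \<in> subformulas A \<Longrightarrow> B \<in> subformulas A"
    and "DBox B \<in> subformulas A \<Longrightarrow> B \<in> subformulas A"
  using subformulas_trans subformulas_self by fastforce+

text \<open>\<open>R\<close> interprets \<open>Box\<close>. The relation of \<open>DBox\<close> relates all distinct points, and every
  point outside \<open>I\<close> to itself. \<open>AT\<^sub>1\<close> makes the points of \<open>I\<close> minimal; \<open>DS\<close> gives them
  proper successors.\<close>

definition DT1S_frame :: "'w set \<Rightarrow> 'w set \<Rightarrow> ('w \<Rightarrow> 'w \<Rightarrow> bool) \<Rightarrow> bool" where
  "DT1S_frame W I R \<longleftrightarrow> W \<noteq> {} \<and> I \<subseteq> W \<and> reflp R \<and> transp R \<and>
     (\<forall>i\<in>I. \<forall>w\<in>W. R w i \<longrightarrow> w = i) \<and> (\<forall>i\<in>I. \<exists>w\<in>W. w \<noteq> i \<and> R i w)"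

text \<open>The worlds are the sets of those formulas of \<open>\<Psi>\<close> that are true in them.\<close>

definition type_model ::
  "form set \<Rightarrow> form set set \<Rightarrow> form set set \<Rightarrow> (form set \<Rightarrow> form set \<Rightarrow> bool) \<Rightarrow> bool" where
  "type_model \<Psi> W I R \<longleftrightarrow> (\<forall>T\<in>W. Bot \<notin> T \<and>
     (\<forall>B C. (B \<rightarrow>\<^sub>F C) \<in> \<Psi> \<longrightarrow> ((B \<rightarrow>\<^sub>F C) \<in> T \<longleftrightarrow> (B \<in> T \<longrightarrow> C \<in> T))) \<and>
     (\<forall>B. Box B \<in> \<Psi> \<longrightarrow> (Box B \<in> T \<longleftrightarrow> (\<forall>T'\<in>W. R T T' \<longrightarrow> B \<in> T'))) \<and>
     (\<forall>B. DBox B \<in> \<Psi> \<longrightarrow> (DBox B \<in> T \<longleftrightarrow> (\<forall>T'\<in>W. T' \<noteq> T \<or> T \<notin> I \<longrightarrow> B \<in> T'))))"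

text \<open>A generated submodel is taken before filtrating: only there do all distinct worlds see
  each other under \<open>DBox\<close>, which brings the relation close to true difference.\<close>

lemma finite_model_property:
  assumes L: "logic L" and ax: "S4DT1S_axioms \<subseteq> L" and A: "A \<notin> L"
  obtains W I R T where "finite W" "DT1S_frame W I R" "type_model (subformulas A) W I R"
    and "T \<in> W" "A \<notin> T"
proof -
  obtain \<Gamma> where \<Gamma>: "mcs L \<Gamma>" "A \<notin> \<Gamma>"
    using A by (rule Lindenbaum[OF L closed_theory_logic[OF L]])
  have sym: "acc DBox N M" if "mcs L M" "mcs L N" "acc DBox M N" for M N
    using acc_DBox_sym[OF L _ that] ax by simp
  have tr: "acc DBox M K" if "mcs L M" "mcs L N" "mcs L K" "acc DBox M N" "acc DBox N K" "M \<noteq> K" for M N K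
    using acc_DBox_trans[OF L _ that] ax by simp
  \<comment> \<open>By symmetry and weak transitivity, distinct members of \<open>C\<close> are
    \<open>DBox\<close>-related. \<open>C\<close> is closed under \<open>DBox\<close>-successors
    and, by \<open>ax_Dbox\<close>, under \<open>Box\<close>-successors.\<close>
  define C where "C = {\<Delta>. mcs L \<Delta> \<and> (\<Delta> = \<Gamma> \<or> acc DBox \<Gamma> \<Delta>)}"
  have C_mcs: "mcs L \<Delta>" if "\<Delta> \<in> C" for \<Delta> using that by (simp add: C_def)
  have C_acc: "acc DBox \<Delta> \<Theta>" if "\<Delta> \<in> C" "\<Theta> \<in> C" "\<Delta> \<noteq> \<Theta>" for \<Delta> \<Theta>
  proof -
    consider "\<Delta> = \<Gamma>" | "\<Theta> = \<Gamma>" | "acc DBox \<Gamma> \<Delta>" "acc DBox \<Gamma> \<Theta>"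
      using \<open>\<Delta> \<in> C\<close> \<open>\<Theta> \<in> C\<close> by (auto simp: C_def)
    then show ?thesis
    proof cases
      case 1 then show ?thesis using that by (auto simp: C_def)
    next
      case 2 then show ?thesis using that sym \<Gamma>(1) by (auto simp: C_def)
    next
      case 3 then show ?thesis using that sym \<Gamma>(1) tr[of \<Delta> \<Gamma> \<Theta>] C_mcs by blast
    qed
  qed
  have C_D: "N \<in> C" if "\<Delta> \<in> C" "mcs L N" "acc DBox \<Delta> N" for \<Delta> N
  proof (cases "\<Delta> = \<Gamma> \<or> N = \<Gamma>")
    case True then show ?thesis using that by (auto simp: C_def)
  next
    case False
    then have "acc DBox \<Gamma> \<Delta>" using that by (auto simp: C_def)
    then have "acc DBox \<Gamma> N" using tr[OF \<Gamma>(1) C_mcs[OF that(1)] that(2) _ that(3)] False by blast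
    then show ?thesis using that by (simp add: C_def)
  qed
  have C_B: "N \<in> C" if "\<Delta> \<in> C" "mcs L N" "acc Box \<Delta> N" for \<Delta> N
  proof (cases "\<Delta> = N")
    case True then show ?thesis using that by simp
  next
    case False
    then have "acc DBox \<Delta> N"
      using acc_Box_imp_DBox[OF L _ C_mcs[OF that(1)] that(2,3)] ax by simp
    then show ?thesis by (rule C_D[OF that(1,2)])
  qed
  let ?\<Psi> = "subformulas A"
  define t where "t \<Delta> = \<Delta> \<inter> ?\<Psi>" for \<Delta>
  \<comment> \<open>The least filtration. It may fail to be transitive, so its reflexive transitive
    closure becomes the frame relation.\<close>
  define R0 where "R0 T T' \<longleftrightarrow> (\<exists>\<Delta>\<in>C. \<exists>\<Delta>'\<in>C. t \<Delta> = T \<and> t \<Delta>' = T' \<and> acc Box \<Delta> \<Delta>')" for T T'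
  \<comment> \<open>\<open>\<Delta>\<close> and \<open>\<Delta>'\<close> may coincide. As distinct
    worlds of \<open>C\<close> are \<open>DBox\<close>-related, a type in \<open>I\<close> is
    realized by exactly one world, and this world does not see itself under
    \<open>DBox\<close>.\<close>
  define I where "I = {T \<in> t ` C. \<not> (\<exists>\<Delta>\<in>C. \<exists>\<Delta>'\<in>C. t \<Delta> = T \<and> t \<Delta>' = T \<and> acc DBox \<Delta> \<Delta>')}"
  have fin: "finite (t ` C)"
    by (rule finite_subset[of _ "Pow ?\<Psi>"]) (auto simp: t_def finite_subformulas)
  have "\<Gamma> \<in> C" using \<Gamma> by (simp add: C_def)
  \<comment> \<open>A \<open>Box\<close>-step into the world of type \<open>i\<close> from a world
    of another type, which is seen back under \<open>DBox\<close>, would make it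
    \<open>DBox\<close>-reflexive by \<open>acc_AT1\<close>.\<close>
  have min: "T = i" if "R0\<^sup>*\<^sup>* T i" "i \<in> I" for T i
    using that
  proof (induction rule: converse_rtranclp_induct)
    case (step T T')
    then have "T' = i" by blast
    then obtain \<Delta> \<Delta>' where \<Delta>: "\<Delta> \<in> C" "\<Delta>' \<in> C" "t \<Delta> = T" "t \<Delta>' = i" "acc Box \<Delta> \<Delta>'"
      using step(1) by (auto simp: R0_def)
    show ?case
    proof (rule ccontr)
      assume "T \<noteq> i"
      then have "acc DBox \<Delta>' \<Delta>" using \<Delta> C_acc[of \<Delta>' \<Delta>] by blast
      then have "acc DBox \<Delta>' \<Delta>'"
        using acc_AT1[OF L _ C_mcs[OF \<Delta>(2)] _ \<Delta>(5)] ax by simp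
      then show False using \<Delta> \<open>i \<in> I\<close> by (auto simp: I_def)
    qed
  qed simp
  \<comment> \<open>The world supplied by \<open>acc_DS\<close> is also a
    \<open>DBox\<close>-successor, so it cannot have the type \<open>i\<close>.\<close>
  have succ: "\<exists>w\<in>t ` C. w \<noteq> i \<and> R0\<^sup>*\<^sup>* i w" if i: "i \<in> I" for i
  proof -
    obtain \<Delta> where \<Delta>: "\<Delta> \<in> C" "t \<Delta> = i" using i by (auto simp: I_def)
    obtain N where N: "mcs L N" "acc Box \<Delta> N" "acc DBox \<Delta> N"
      using acc_DS[OF L _ C_mcs[OF \<Delta>(1)]] ax by (metis insert_subset)
    have "N \<in> C" using C_D \<Delta> N by blast
    moreover have "t N \<noteq> i" using i \<Delta> N \<open>N \<in> C\<close> by (auto simp: I_def)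
    moreover have "R0 i (t N)" using \<Delta> N \<open>N \<in> C\<close> by (auto simp: R0_def)
    ultimately show ?thesis by blast
  qed
  have frame: "DT1S_frame (t ` C) I R0\<^sup>*\<^sup>*"
    unfolding DT1S_frame_def
  proof (intro conjI)
    show "t ` C \<noteq> {}" using \<open>\<Gamma> \<in> C\<close> by blast
    show "I \<subseteq> t ` C" by (auto simp: I_def)
    show "reflp R0\<^sup>*\<^sup>*" by (simp add: reflpI)
    show "transp R0\<^sup>*\<^sup>*" by (rule transpI) simp
    show "\<forall>i\<in>I. \<forall>w\<in>t ` C. R0\<^sup>*\<^sup>* w i \<longrightarrow> w = i" by (simp add: min)
    show "\<forall>i\<in>I. \<exists>w\<in>t ` C. w \<noteq> i \<and> R0\<^sup>*\<^sup>* i w" by (intro ballI succ)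
  qed
  have box: "Box B \<in> T \<longleftrightarrow> (\<forall>T'\<in>t ` C. R0\<^sup>*\<^sup>* T T' \<longrightarrow> B \<in> T')"
    if T: "T \<in> t ` C" and B: "Box B \<in> ?\<Psi>" for T B
  proof (intro iffI ballI impI)
    fix T' assume "Box B \<in> T" "T' \<in> t ` C" and R: "R0\<^sup>*\<^sup>* T T'"
    \<comment> \<open>Along a path of \<open>R0\<close> it is \<open>Box B\<close>, not
      \<open>B\<close>, that is handed on, by \<open>ax_4box\<close>; reflexivity of
      \<open>Box\<close> extracts \<open>B\<close> at the end.\<close>
    have "Box B \<in> T'" using R \<open>Box B \<in> T\<close>
    proof (induction rule: rtranclp_induct)
      case (step T' T'')
      then obtain \<Delta> \<Delta>' where \<Delta>: "\<Delta> \<in> C" "t \<Delta> = T'" "t \<Delta>' = T''" "acc Box \<Delta> \<Delta>'"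
        by (auto simp: R0_def)
      have "Box B \<in> \<Delta>" using step \<Delta> by (auto simp: t_def)
      then have "Box (Box B) \<in> \<Delta>" using mcs_4box[OF L _ C_mcs[OF \<Delta>(1)]] ax by simp
      then have "Box B \<in> \<Delta>'" by (rule accD[OF \<Delta>(4)])
      then show ?case using \<Delta>(3) B by (auto simp: t_def)
    qed
    moreover obtain \<Delta> where \<Delta>: "\<Delta> \<in> C" "t \<Delta> = T'" using \<open>T' \<in> t ` C\<close> by blast
    moreover have "acc Box \<Delta> \<Delta>" using acc_Box_refl[OF L _ C_mcs[OF \<Delta>(1)]] ax by simp
    ultimately have "B \<in> \<Delta>" using accD[of Box \<Delta> \<Delta> B] by (auto simp: t_def)
    then show "B \<in> T'" using \<Delta>(2) subformulas_closed(3)[OF B] by (auto simp: t_def)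
  next
    assume *: "\<forall>T'\<in>t ` C. R0\<^sup>*\<^sup>* T T' \<longrightarrow> B \<in> T'"
    obtain \<Delta> where \<Delta>: "\<Delta> \<in> C" "t \<Delta> = T" using T by blast
    have "B \<in> N" if N: "mcs L N" "acc Box \<Delta> N" for N
    proof -
      have "N \<in> C" using C_B \<Delta> N by blast
      moreover from this have "R0 T (t N)" using \<Delta> N by (auto simp: R0_def)
      ultimately have "B \<in> t N" using * by blast
      then show ?thesis by (simp add: t_def)
    qed
    then have "Box B \<in> \<Delta>" using mcs_acc[OF L C_mcs[OF \<Delta>(1)], of Box] by blast
    then show "Box B \<in> T" using \<Delta> B by (auto simp: t_def)
  qed
  have dbox: "DBox B \<in> T \<longleftrightarrow> (\<forall>T'\<in>t ` C. T' \<noteq> T \<or> T \<notin> I \<longrightarrow> B \<in> T')"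
    if T: "T \<in> t ` C" and B: "DBox B \<in> ?\<Psi>" for T B
  proof (intro iffI ballI impI)
    fix T' assume DB: "DBox B \<in> T" and T': "T' \<in> t ` C" and *: "T' \<noteq> T \<or> T \<notin> I"
    \<comment> \<open>If \<open>T' = T\<close>, then \<open>T\<close> is outside \<open>I\<close>,
      whose definition supplies the two worlds; otherwise worlds of the two types are distinct and
      hence related.\<close>
    obtain \<Delta> \<Delta>' where "\<Delta> \<in> C" "t \<Delta> = T" "\<Delta>' \<in> C" "t \<Delta>' = T'" "acc DBox \<Delta> \<Delta>'"
    proof (cases "T' = T")
      case True
      then show thesis using * T that by (auto simp: I_def)
    next
      case False
      then show thesis using T T' that C_acc by blast
    qed
    moreover from this have "DBox B \<in> \<Delta>" using DB by (auto simp: t_def)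
    ultimately have "B \<in> \<Delta>'" using accD[of DBox \<Delta> \<Delta>' B] by blast
    then show "B \<in> T'" using \<open>t \<Delta>' = T'\<close> subformulas_closed(4)[OF B] by (auto simp: t_def)
  next
    assume *: "\<forall>T'\<in>t ` C. T' \<noteq> T \<or> T \<notin> I \<longrightarrow> B \<in> T'"
    obtain \<Delta> where \<Delta>: "\<Delta> \<in> C" "t \<Delta> = T" using T by blast
    have "B \<in> N" if N: "mcs L N" "acc DBox \<Delta> N" for N
    proof -
      have "N \<in> C" using C_D \<Delta> N by blast
      moreover from this have "t N \<noteq> T \<or> T \<notin> I" using \<Delta> N by (auto simp: I_def)
      ultimately have "B \<in> t N" using * by blast
      then show ?thesis by (simp add: t_def)
    qed
    then have "DBox B \<in> \<Delta>" using mcs_acc[OF L C_mcs[OF \<Delta>(1)], of DBox] by blast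
    then show "DBox B \<in> T" using \<Delta> B by (auto simp: t_def)
  qed
  have "Bot \<notin> t \<Delta>" if "\<Delta> \<in> C" for \<Delta> using mcs_Bot[OF C_mcs[OF that]] by (simp add: t_def)
  moreover have "(B \<rightarrow>\<^sub>F D) \<in> t \<Delta> \<longleftrightarrow> (B \<in> t \<Delta> \<longrightarrow> D \<in> t \<Delta>)"
    if "\<Delta> \<in> C" "(B \<rightarrow>\<^sub>F D) \<in> ?\<Psi>" for \<Delta> B D
    using that(2) mcs_Imp[OF L C_mcs[OF that(1)]] subformulas_closed(1,2)[OF that(2)]
    by (simp add: t_def)
  ultimately have "type_model ?\<Psi> (t ` C) I R0\<^sup>*\<^sup>*"
    unfolding type_model_def using box dbox by auto
  moreover have "t \<Gamma> \<in> t ` C" "A \<notin> t \<Gamma>" using \<open>\<Gamma> \<in> C\<close> \<Gamma>(2) by (auto simp: t_def)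
  ultimately show thesis using fin frame that by blast
qed

section \<open>Maps from zero-dimensional metric spaces onto finite frames\<close>

text \<open>The index codes a pair: its first component selects the element, its second is a counter
  that makes each element return.\<close>

lemma enumerate_infinitely_often:
  assumes "countable A" "A \<noteq> {}"
  obtains s :: "nat \<Rightarrow> 'b" where "\<And>n. s n \<in> A" "\<And>a N. a \<in> A \<Longrightarrow> \<exists>n\<ge>N. s n = a"
proof
  let ?s = "\<lambda>n. from_nat_into A (fst (prod_decode n))"
  show "?s n \<in> A" for n using assms by (simp add: from_nat_into)
  show "\<exists>n\<ge>N. ?s n = a" if "a \<in> A" for a N
    using assms(1) that by (intro exI[of _ "prod_encode (to_nat_on A a, N)"]) (simp add: le_prod_encode_2)
qed

section \<open>Neighbourhoods and clopen sets in a metric space\<close>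

locale zero_dim_metric = Metric_space M d for M :: "'a set" and d +
  assumes no_isolated: "\<And>x r. x \<in> M \<Longrightarrow> r > 0 \<Longrightarrow> \<exists>y\<in>M. y \<noteq> x \<and> d x y < r"
    and clopen_base: "\<And>x r. x \<in> M \<Longrightarrow> r > 0 \<Longrightarrow>
      \<exists>U. openin mtopology U \<and> closedin mtopology U \<and> x \<in> U \<and> U \<subseteq> mball x r"
begin

text \<open>For \<open>x\<close> in \<open>M\<close>, this is the neighbourhood filter of
  \<open>x\<close>. Neighbourhoods are not punctured: \<open>P\<close> holds at \<open>x\<close>
  too.\<close>

definition near :: "'a \<Rightarrow> ('a \<Rightarrow> bool) \<Rightarrow> bool" where
  "near x P \<longleftrightarrow> (\<exists>r>0. \<forall>y\<in>M. d x y < r \<longrightarrow> P y)"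

lemma near_mono: "near x P \<Longrightarrow> (\<And>y. y \<in> M \<Longrightarrow> P y \<Longrightarrow> Q y) \<Longrightarrow> near x Q"
  unfolding near_def by meson

lemma near_conj:
  assumes "near x P" "near x Q"
  shows "near x (\<lambda>y. P y \<and> Q y)"
proof -
  obtain r s where "r > 0" "\<forall>y\<in>M. d x y < r \<longrightarrow> P y" "s > 0" "\<forall>y\<in>M. d x y < s \<longrightarrow> Q y"
    using assms by (auto simp: near_def)
  then show ?thesis unfolding near_def by (intro exI[of _ "min r s"]) auto
qed

lemma near_dist: "r > 0 \<Longrightarrow> near x (\<lambda>y. d x y < r)"
  by (auto simp: near_def)

lemma near_True: "near x (\<lambda>y. True)"
  by (auto simp: near_def intro: exI[of _ 1])

lemma near_other: "near x P \<Longrightarrow> x \<in> M \<Longrightarrow> \<exists>y\<in>M. y \<noteq> x \<and> P y"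
  unfolding near_def using no_isolated by meson

lemma near_singleton: "x \<in> M \<Longrightarrow> near x (\<lambda>y. y = a \<longrightarrow> y = x)"
  by (cases "a = x \<or> a \<notin> M") (auto simp: near_def mdist_pos_eq intro: exI[of _ "d x a"] exI[of _ 1])

lemma near_finite:
  assumes "finite A" "\<And>a. a \<in> A \<Longrightarrow> near x (P a)"
  shows "near x (\<lambda>y. \<forall>a\<in>A. P a y)"
  using assms
proof (induction A rule: finite_induct)
  case (insert a A)
  then have "near x (\<lambda>y. P a y \<and> (\<forall>a\<in>A. P a y))" by (intro near_conj) auto
  then show ?case by simp
qed (simp add: near_True)

abbreviation locally_const :: "'a \<Rightarrow> ('a \<Rightarrow> 'b) \<Rightarrow> bool" where
  "locally_const x g \<equiv> near x (\<lambda>y. g y = g x)"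

text \<open>\<open>x\<close> is not an accumulation point of \<open>E\<close>, whether or not it
  belongs to \<open>E\<close>.\<close>

abbreviation discrete_at :: "'a \<Rightarrow> 'a set \<Rightarrow> bool" where
  "discrete_at x E \<equiv> near x (\<lambda>y. y \<in> E \<longrightarrow> y = x)"

lemma discrete_at_Un: "discrete_at x E \<Longrightarrow> discrete_at x F \<Longrightarrow> discrete_at x (E \<union> F)"
  by (rule near_mono[OF near_conj]) auto

text \<open>A set is clopen iff its characteristic function is locally constant.\<close>

definition clopen :: "'a set \<Rightarrow> bool" where
  "clopen U \<longleftrightarrow> U \<subseteq> M \<and> (\<forall>x\<in>M. locally_const x (\<lambda>y. y \<in> U))"

lemma clopenI:
  assumes U: "openin mtopology U" "closedin mtopology U"
  shows "clopen U"
  unfolding clopen_def near_def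
proof (intro conjI ballI)
  show "U \<subseteq> M" using U(1) by (simp add: openin_mtopology)
  fix x assume "x \<in> M"
  show "\<exists>r>0. \<forall>y\<in>M. d x y < r \<longrightarrow> (y \<in> U) = (x \<in> U)"
  proof (cases "x \<in> U")
    case True
    then obtain r where "r > 0" "mball x r \<subseteq> U" using U(1) by (auto simp: openin_mtopology)
    then show ?thesis using True \<open>x \<in> M\<close> by (intro exI[of _ r]) auto
  next
    case False
    then obtain r where "r > 0" "disjnt U (mball x r)"
      using U(2) \<open>x \<in> M\<close> by (auto simp: closedin_metric)
    then show ?thesis using False \<open>x \<in> M\<close> by (intro exI[of _ r]) (auto simp: disjnt_iff)
  qed
qed

lemma clopen_nbhd:
  assumes "x \<in> M" "near x P"
  obtains U where "clopen U" "x \<in> U" "\<And>y. y \<in> U \<Longrightarrow> P y"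
proof -
  obtain r where r: "r > 0" "\<And>y. y \<in> M \<Longrightarrow> d x y < r \<Longrightarrow> P y" using assms(2) by (auto simp: near_def)
  obtain U where U: "openin mtopology U" "closedin mtopology U" "x \<in> U" "U \<subseteq> mball x r"
    using clopen_base[OF assms(1) r(1)] by blast
  show thesis
  proof
    show "clopen U" using U by (simp add: clopenI)
    show "P y" if "y \<in> U" for y using that U(4) r(2) by auto
  qed (rule U)
qed

text \<open>By Zorn's lemma: a point of \<open>P\<close> with no point of \<open>D\<close> within
  \<epsilon> could be added to a maximal separated set \<open>D\<close>.\<close>

lemma maximal_separated:
  assumes "P \<subseteq> M" "\<epsilon> > 0"
  shows "\<exists>D\<subseteq>P. (\<forall>x\<in>D. \<forall>y\<in>D. d x y < \<epsilon> \<longrightarrow> x = y) \<and> (\<forall>p\<in>P. \<exists>y\<in>D. d p y < \<epsilon>)"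
proof -
  let ?\<A> = "{D. D \<subseteq> P \<and> pairwise (\<lambda>x y. \<not> d x y < \<epsilon>) D}"
  have "?\<A> \<noteq> {}" by (auto intro: exI[of _ "{}"])
  moreover have "\<Union>\<C> \<in> ?\<A>" if "subset.chain ?\<A> \<C>" for \<C>
  proof -
    have \<C>: "\<C> \<subseteq> ?\<A>" "chain\<^sub>\<subseteq> \<C>"
      using that unfolding subset_chain_def chain_subset_def by blast+
    have "pairwise (\<lambda>x y. \<not> d x y < \<epsilon>) (\<Union>\<C>)"
      using \<C> by (intro pairwise_chain_Union) auto
    then show ?thesis using \<C>(1) by auto
  qed
  ultimately obtain D where D: "D \<in> ?\<A>" and max: "\<forall>X\<in>?\<A>. D \<subseteq> X \<longrightarrow> X = D"
    using subset_Zorn_nonempty[of ?\<A>] by meson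
  show ?thesis
  proof (intro exI[of _ D] conjI ballI)
    show "D \<subseteq> P" using D by blast
    show "d x y < \<epsilon> \<longrightarrow> x = y" if "x \<in> D" "y \<in> D" for x y
      using D that by (auto simp: pairwise_def)
    show "\<exists>y\<in>D. d p y < \<epsilon>" if "p \<in> P" for p
    proof (rule ccontr)
      assume *: "\<not> (\<exists>y\<in>D. d p y < \<epsilon>)"
      then have "insert p D \<in> ?\<A>" using D that by (auto simp: pairwise_insert commute)
      then have "insert p D = D" using max by blast
      then have "p \<in> D" by blast
      then show False using * that assms by (metis mdist_zero subsetD)
    qed
  qed
qed

text \<open>In an arbitrary metric space with a clopen base, a cover by small clopen sets need not have a
  disjoint clopen refinement. Clopen neighbourhoods of a separated set suffice here: they form a
  discrete family, so that their union is clopen.\<close>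

lemma stage:
  assumes g: "\<forall>x\<in>M - K. locally_const x g"
    and E: "K \<subseteq> E" "E \<subseteq> M" "\<forall>x\<in>M - K. discrete_at x E" and "\<epsilon> > 0"
  shows "\<exists>g' E'. (\<forall>x\<in>M - K. locally_const x g') \<and> E \<subseteq> E' \<and> E' \<subseteq> M \<and>
    (\<forall>x\<in>M - K. discrete_at x E') \<and>
    (\<forall>x\<in>M - K. g' x = g x \<or> (R (g x) v \<and> g' x = v)) \<and> (\<forall>x\<in>E. g' x = g x) \<and>
    (\<forall>x\<in>M - K. R (g x) v \<longrightarrow> (\<exists>y\<in>E' - E. d x y < \<epsilon> \<and> g' y = v))"
proof -
  note lc = bspec[OF g] and disc = bspec[OF E(3)]
  \<comment> \<open>The points not yet fixed whose label may be raised to \<open>v\<close>. They are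
    separated at scale \<epsilon>/2, as the other half of \<epsilon> is spent on reaching
    \<open>P\<close>.\<close>
  define P where "P = {x \<in> M - E. R (g x) v}"
  have "P \<subseteq> M" "\<epsilon>/2 > 0" using \<open>\<epsilon> > 0\<close> by (auto simp: P_def)
  then obtain D where D: "D \<subseteq> P" and sep: "\<And>x y. x \<in> D \<Longrightarrow> y \<in> D \<Longrightarrow> d x y < \<epsilon>/2 \<Longrightarrow> x = y"
    and max: "\<And>p. p \<in> P \<Longrightarrow> \<exists>y\<in>D. d p y < \<epsilon>/2"
    using maximal_separated[of P "\<epsilon>/2"] by meson
  have DM: "y \<in> M - K" "y \<notin> E" "R (g y) v" if "y \<in> D" for y
    using that D E(1) by (auto simp: P_def)
  have "\<exists>U. clopen U \<and> y \<in> U \<and> (\<forall>z\<in>U. z \<notin> E \<and> g z = g y \<and> d y z < \<epsilon>/6)" if y: "y \<in> D" for y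
  proof -
    have "near y (\<lambda>z. (z \<in> E \<longrightarrow> z = y) \<and> g z = g y \<and> d y z < \<epsilon>/6)"
      using DM[OF y] \<open>\<epsilon> > 0\<close> by (intro near_conj near_dist lc disc) auto
    then obtain U where "clopen U" "y \<in> U" "\<And>z. z \<in> U \<Longrightarrow> (z \<in> E \<longrightarrow> z = y) \<and> g z = g y \<and> d y z < \<epsilon>/6"
      using clopen_nbhd[of y] DM[OF y] by blast
    then show ?thesis using DM(2)[OF y] by blast
  qed
  then obtain U where U: "\<And>y. y \<in> D \<Longrightarrow> clopen (U y)" "\<And>y. y \<in> D \<Longrightarrow> y \<in> U y"
    "\<And>y z. y \<in> D \<Longrightarrow> z \<in> U y \<Longrightarrow> z \<notin> E \<and> g z = g y \<and> d y z < \<epsilon>/6"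
    by metis
  have UM: "z \<in> M" if "y \<in> D" "z \<in> U y" for y z using U(1)[OF that(1)] that(2) by (auto simp: clopen_def)
  define V where "V = (\<Union>y\<in>D. U y)"
  \<comment> \<open>If \<open>U y\<close> and \<open>U y'\<close> both come within \<epsilon>/12 of
    \<open>z\<close>, their centres are less than 2(\<epsilon>/6 + \<epsilon>/12) = \<epsilon>/2
    apart, hence equal. So near \<open>z\<close> the union agrees with at most one clopen
    set.\<close>
  have V: "locally_const z (\<lambda>w. w \<in> V)" if z: "z \<in> M" for z
  proof (cases "\<exists>y\<in>D. \<exists>w\<in>U y. d z w < \<epsilon>/12")
    case True
    then obtain y w where y: "y \<in> D" "w \<in> U y" "d z w < \<epsilon>/12" by blast
    have *: "y' = y" if y': "y' \<in> D" "w' \<in> U y'" "d z w' < \<epsilon>/12" for y' w'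
    proof (rule sep[OF y'(1) y(1)])
      have "d y' y \<le> d y' w' + d w' y" "d w' y \<le> d w' z + d z y" "d z y \<le> d z w + d w y"
        using UM y y' z DM(1) by (auto intro!: triangle)
      moreover have "d y w < \<epsilon>/6" "d y' w' < \<epsilon>/6" using U(3) y y' by blast+
      ultimately show "d y' y < \<epsilon>/2" using y(3) y'(3) by (simp add: commute)
    qed
    have "near z (\<lambda>w. d z w < \<epsilon>/12 \<and> (w \<in> U y) = (z \<in> U y))"
      using U(1)[OF y(1)] z \<open>\<epsilon> > 0\<close> by (intro near_conj near_dist) (auto simp: clopen_def)
    then show ?thesis
    proof (rule near_mono)
      fix w' assume w': "d z w' < \<epsilon>/12 \<and> (w' \<in> U y) = (z \<in> U y)"
      have "d z z < \<epsilon>/12" using z \<open>\<epsilon> > 0\<close> by simp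
      then show "(w' \<in> V) = (z \<in> V)" using w' * y(1) unfolding V_def by blast
    qed
  next
    case False
    then have "w \<notin> V" if "d z w < \<epsilon>/12" for w using that by (auto simp: V_def)
    moreover have "d z z < \<epsilon>/12" using z \<open>\<epsilon> > 0\<close> by simp
    ultimately show ?thesis using near_dist[of "\<epsilon>/12" z] \<open>\<epsilon> > 0\<close> by (auto elim!: near_mono)
  qed
  define g' where "g' x = (if x \<in> V then v else g x)" for x
  have VE: "x \<notin> V" if "x \<in> E" for x using that U(3) by (auto simp: V_def)
  have isoD: "discrete_at x D" if x: "x \<in> M" for x
  proof (cases "\<exists>y\<in>D. d x y < \<epsilon>/4")
    case True
    then obtain y where y: "y \<in> D" "d x y < \<epsilon>/4" by blast
    have *: "y' = y" if y': "y' \<in> D" "d x y' < \<epsilon>/4" for y'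
    proof (rule sep[OF y'(1) y(1)])
      have "d y' y \<le> d y' x + d x y" using y y' x DM by (auto intro!: triangle)
      then show "d y' y < \<epsilon>/2" using y y' by (simp add: commute)
    qed
    have "near x (\<lambda>z. (z = y \<longrightarrow> z = x) \<and> d x z < \<epsilon>/4)"
      using x \<open>\<epsilon> > 0\<close> by (intro near_conj near_dist near_singleton) auto
    then show ?thesis using * by (auto elim!: near_mono)
  next
    case False
    then show ?thesis using near_dist[of "\<epsilon>/4" x] \<open>\<epsilon> > 0\<close> by (auto elim!: near_mono)
  qed
  show ?thesis
  proof (intro exI[of _ g'] exI[of _ "E \<union> D"] conjI ballI impI)
    show "locally_const x g'" if x: "x \<in> M - K" for x
      using near_conj[OF lc[OF x] V[of x]] x by (auto simp: g'_def elim!: near_mono)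
    show "E \<subseteq> E \<union> D" by blast
    show "E \<union> D \<subseteq> M" using E(2) DM by blast
    show "discrete_at x (E \<union> D)" if x: "x \<in> M - K" for x
      using discrete_at_Un[OF disc[OF x] isoD[of x]] x by simp
    show "g' x = g x \<or> (R (g x) v \<and> g' x = v)" if "x \<in> M - K" for x
    proof (cases "x \<in> V")
      case True
      then obtain y where "y \<in> D" "x \<in> U y" by (auto simp: V_def)
      then have "R (g x) v" using U(3) DM(3) by metis
      then show ?thesis using True by (simp add: g'_def)
    qed (simp add: g'_def)
    show "g' x = g x" if "x \<in> E" for x using VE[OF that] by (simp add: g'_def)
    show "\<exists>y\<in>E \<union> D - E. d x y < \<epsilon> \<and> g' y = v" if x: "x \<in> M - K" and R: "R (g x) v" for x
    proof -
      \<comment> \<open>\<open>x\<close> may itself lie in \<open>E\<close>, so a nearby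
        \<open>p\<close> outside \<open>E\<close> with the same label is chosen first. It exists
        because \<open>E\<close> does not accumulate at \<open>x\<close> and \<open>x\<close> is not
        isolated.\<close>
      have "near x (\<lambda>y. (y \<in> E \<longrightarrow> y = x) \<and> g y = g x \<and> d x y < \<epsilon>/2)"
        using x \<open>\<epsilon> > 0\<close> by (intro near_conj near_dist lc disc) auto
      then obtain p where p: "p \<in> M" "p \<notin> E" "g p = g x" "d x p < \<epsilon>/2"
        using near_other[of x] x by blast
      then have "p \<in> P" using R by (simp add: P_def)
      then obtain y where y: "y \<in> D" "d p y < \<epsilon>/2" using max by blast
      have "d x y \<le> d x p + d p y" using x p y DM by (auto intro!: triangle)
      then have "d x y < \<epsilon>" using p y by simp
      moreover have "g' y = v" using U(2) y by (auto simp: g'_def V_def)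
      ultimately show ?thesis using y(1) DM(2) by blast
    qed
  qed
qed

text \<open>\<open>g n\<close> are the labels at stage \<open>n\<close>, and \<open>E n\<close> is the set of points whose label is final. The map
  \<open>f\<close> is only controlled outside \<open>K\<close>, the future fibres over \<open>I\<close>.\<close>

lemma interior_map:
  fixes W :: "'w set"
  assumes W: "finite W" "W \<noteq> {}" and R: "reflp R" "transp R"
    and g0: "\<forall>x\<in>M - K. locally_const x g0" "\<forall>x\<in>M - K. g0 x \<in> W"
    and E0: "K \<subseteq> E0" "E0 \<subseteq> M" "\<forall>x\<in>M - K. discrete_at x E0"
  shows "\<exists>f. (\<forall>x\<in>M - K. f x \<in> W \<and> R (g0 x) (f x)) \<and>
    (\<forall>x\<in>M - K. near x (\<lambda>y. y \<notin> K \<and> R (f x) (f y))) \<and>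
    (\<forall>x\<in>M - K. \<forall>v\<in>W. \<forall>r>0. R (f x) v \<longrightarrow> (\<exists>y\<in>M - E0. d x y < r \<and> f y = v)) \<and>
    (\<forall>x\<in>E0 - K. f x = g0 x)"
proof -
  \<comment> \<open>Stage \<open>n\<close> treats the label \<open>s n\<close> at scale
    \<open>1 / real (Suc n)\<close>; a label has to return infinitely often to be treated at
    arbitrarily small scales.\<close>
  obtain s :: "nat \<Rightarrow> 'w" where s: "\<And>n. s n \<in> W" "\<And>w N. w \<in> W \<Longrightarrow> \<exists>n\<ge>N. s n = w"
    using enumerate_infinitely_often[OF countable_finite[OF W(1)] W(2)] by metis
  define inv where "inv S \<longleftrightarrow> (case S of (g, E) \<Rightarrow>
      (\<forall>x\<in>M - K. locally_const x g \<and> g x \<in> W \<and> discrete_at x E) \<and> K \<subseteq> E \<and> E \<subseteq> M)" for S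
  define succ where "succ n S S' \<longleftrightarrow> (case S of (g, E) \<Rightarrow> case S' of (g', E') \<Rightarrow>
      E \<subseteq> E' \<and> (\<forall>x\<in>M - K. R (g x) (g' x)) \<and> (\<forall>x\<in>E. g' x = g x) \<and>
      (\<forall>x\<in>M - K. R (g x) (s n) \<longrightarrow> (\<exists>y\<in>E' - E. d x y < 1 / real (Suc n) \<and> g' y = s n)))" for n S S'
  have "\<exists>S. \<forall>n. (inv (S n) \<and> (n = 0 \<longrightarrow> S n = (g0, E0))) \<and> succ n (S n) (S (Suc n))"
  proof (rule dependent_nat_choice)
    show "\<exists>S. inv S \<and> (0 = 0 \<longrightarrow> S = (g0, E0))" using g0 E0 by (auto simp: inv_def)
  next
    fix S :: "('a \<Rightarrow> 'w) \<times> 'a set" and n :: nat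
    assume S: "inv S \<and> (n = 0 \<longrightarrow> S = (g0, E0))"
    obtain g E where gE: "S = (g, E)" by fastforce
    have inv: "\<forall>x\<in>M - K. locally_const x g" "K \<subseteq> E" "E \<subseteq> M"
        "\<forall>x\<in>M - K. discrete_at x E" "\<And>x. x \<in> M - K \<Longrightarrow> g x \<in> W"
      using S by (auto simp: inv_def gE)
    have "0 < 1 / real (Suc n)" by simp
    from stage[OF inv(1-4) this, of R "s n"]
    obtain g' E' where *: "\<forall>x\<in>M - K. locally_const x g'" "E \<subseteq> E'" "E' \<subseteq> M"
      "\<forall>x\<in>M - K. discrete_at x E'"
      "\<forall>x\<in>M - K. g' x = g x \<or> (R (g x) (s n) \<and> g' x = s n)" "\<forall>x\<in>E. g' x = g x"
      "\<forall>x\<in>M - K. R (g x) (s n) \<longrightarrow> (\<exists>y\<in>E' - E. d x y < 1 / real (Suc n) \<and> g' y = s n)"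
      by (elim exE conjE) (rule that)
    have "inv (g', E')"
      unfolding inv_def prod.case
    proof (intro conjI ballI)
      show "g' x \<in> W" if "x \<in> M - K" for x using bspec[OF *(5) that] inv(5)[OF that] s(1)[of n] by auto
      show "K \<subseteq> E'" using inv(2) *(2) by blast
    qed (use * in blast)+
    moreover have "succ n S (g', E')"
      unfolding succ_def prod.case gE
    proof (intro conjI ballI impI)
      show "R (g x) (g' x)" if "x \<in> M - K" for x
        using bspec[OF *(5) that] reflpD[OF R(1)] by auto
    qed (use * in blast)+
    ultimately show "\<exists>S'. (inv S' \<and> (Suc n = 0 \<longrightarrow> S' = (g0, E0))) \<and> succ n S S'" by blast
  qed
  then obtain S where S: "\<And>n. inv (S n)" "S 0 = (g0, E0)" "\<And>n. succ n (S n) (S (Suc n))" by blast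
  define g where "g n = fst (S n)" for n
  define E where "E n = snd (S n)" for n
  have S_eq: "S n = (g n, E n)" for n by (simp add: g_def E_def)
  have zero: "g 0 = g0" "E 0 = E0" by (simp_all add: g_def E_def S)
  have gE: "locally_const x (g n)" "g n x \<in> W" "discrete_at x (E n)" if "x \<in> M - K" for n x
    using S(1)[of n] that unfolding inv_def S_eq by simp_all
  have KE: "K \<subseteq> E n" "E n \<subseteq> M" for n using S(1)[of n] unfolding inv_def S_eq by simp_all
  have step: "E n \<subseteq> E (Suc n)" "x \<in> M - K \<Longrightarrow> R (g n x) (g (Suc n) x)" "x \<in> E n \<Longrightarrow> g (Suc n) x = g n x"
    "x \<in> M - K \<Longrightarrow> R (g n x) (s n) \<Longrightarrow> \<exists>y\<in>E (Suc n) - E n. d x y < 1 / real (Suc n) \<and> g (Suc n) y = s n" for n x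
    using S(3)[of n] unfolding succ_def S_eq by simp_all
  have E_mono: "E m \<subseteq> E n" if "m \<le> n" for m n
    using that step(1) by (rule lift_Suc_mono_le[rotated])
  have frozen: "g n x = g m x" if "m \<le> n" "x \<in> E m" for m n x
    using that(1)
  proof (induction n rule: dec_induct)
    case (step n)
    then have "x \<in> E n" using that(2) E_mono by blast
    then show ?case using \<open>\<And>x n. x \<in> E n \<Longrightarrow> g (Suc n) x = g n x\<close> step by simp
  qed simp
  have R_mono: "R (g m x) (g n x)" if "m \<le> n" "x \<in> M - K" for m n x
    using that(1)
  proof (induction n rule: dec_induct)
    case base then show ?case using R(1) by (rule reflpD)
  next
    case (step n)
    then show ?case using transpD[OF R(2)] \<open>\<And>x n. x \<in> M - K \<Longrightarrow> R (g n x) (g (Suc n) x)\<close> that(2) by blast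
  qed
  have "\<exists>w\<in>W. infinite {n. g n x = w}" if x: "x \<in> M - K" for x
  proof -
    have "finite (range (\<lambda>n. g n x))" by (rule finite_subset[OF _ W(1)]) (use gE(2)[OF x] in blast)
    from pigeonhole_infinite[OF infinite_UNIV_nat this]
    obtain n0 where "infinite {n. g n x = g n0 x}" by auto
    then show ?thesis using gE(2)[OF x] by blast
  qed
  then obtain f where f: "\<And>x. x \<in> M - K \<Longrightarrow> f x \<in> W" "\<And>x. x \<in> M - K \<Longrightarrow> infinite {n. g n x = f x}"
    by metis
  have f_late: "\<exists>n\<ge>m. g n x = f x" if "x \<in> M - K" for x m
    using f(2)[OF that] by (simp add: infinite_nat_iff_unbounded_le)
  have R_f: "R (g n x) (f x)" if "x \<in> M - K" for x n
    using f_late[OF that, of n] R_mono[OF _ that] by metis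
  have f_frozen: "f x = g n x" if "x \<in> E n - K" for x n
    using f_late[of x n] frozen[of n _ x] that KE(2) by (metis Diff_iff subsetD)
  show ?thesis
  proof (intro exI[of _ f] conjI[where P = "\<forall>x\<in>_. _ x"] ballI allI impI)
    show "f x \<in> W \<and> R (g0 x) (f x)" if "x \<in> M - K" for x
      using f(1)[OF that] R_f[OF that, of 0] by (simp add: zero)
    show "f x = g0 x" if "x \<in> E0 - K" for x using f_frozen[of x 0] that by (simp add: zero)
    show "near x (\<lambda>y. y \<notin> K \<and> R (f x) (f y))" if x: "x \<in> M - K" for x
    proof -
      \<comment> \<open>At a stage where \<open>x\<close> bears its value, the points near
        \<open>x\<close> bear the same label and can only climb from it. \<open>E n\<close> contains
        \<open>K\<close> and does not accumulate at \<open>x\<close>, so \<open>K\<close> stays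
        away.\<close>
      obtain n where n: "g n x = f x" using f_late[OF x] by blast
      show ?thesis
      proof (rule near_mono[OF near_conj[OF gE(1)[OF x, of n] gE(3)[OF x, of n]]])
        fix y assume y: "y \<in> M" "g n y = g n x \<and> (y \<in> E n \<longrightarrow> y = x)"
        then have "y \<notin> K" using KE(1)[of n] x by blast
        then show "y \<notin> K \<and> R (f x) (f y)" using R_f[of y n] y n by simp
      qed
    qed
    show "\<exists>y\<in>M - E0. d x y < r \<and> f y = v" if x: "x \<in> M - K" and v: "v \<in> W" "R (f x) v" and "r > 0" for x v r
    proof -
      obtain N where N: "1 / real (Suc N) < r" using nat_approx_posE[OF \<open>r > 0\<close>] by blast
      obtain n where n: "n \<ge> N" "s n = v" using s(2)[OF v(1)] by blast
      \<comment> \<open>\<open>f x\<close> is above every label of \<open>x\<close>, so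
        \<open>v\<close> may be set at any stage; the point \<open>y\<close> chosen at stage
        \<open>n\<close> then keeps the label \<open>v\<close>.\<close>
      have "R (g n x) (s n)" using transpD[OF R(2) R_f[OF x] v(2)] n(2) by simp
      then obtain y where y: "y \<in> E (Suc n) - E n" "d x y < 1 / real (Suc n)" "g (Suc n) y = v"
        using step(4)[OF x] n(2) by blast
      have "f y = v" using f_frozen[of y "Suc n"] y KE(1)[of n] by blast
      moreover have "1 / real (Suc n) \<le> 1 / real (Suc N)" using n(1) by (simp add: frac_le)
      then have "d x y < r" using y(2) N by linarith
      moreover have "y \<in> M - E0" using y(1) KE(2)[of "Suc n"] E_mono[of 0 n] zero by auto
      ultimately show ?thesis by blast
    qed
  qed
qed

text \<open>Clopen neighbourhoods \<open>U n\<close> shrink to \<open>x\<close>; \<open>h\<close>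
  numbers the annuli \<open>U n - U (Suc n)\<close>, \<open>p n\<close> is a point of the annulus
  with number \<open>n\<close>, and the last conjunct is the convergence of \<open>p\<close> to
  \<open>x\<close>.\<close>

lemma annuli:
  assumes x: "x \<in> M"
  shows "\<exists>h p. (\<forall>y\<in>M. y \<noteq> x \<longrightarrow> locally_const y h) \<and>
    (\<forall>n::nat. p n \<in> M \<and> p n \<noteq> x \<and> h (p n) = n) \<and>
    (\<forall>P. near x P \<longrightarrow> (\<exists>N. \<forall>n\<ge>N. P (p n)))"
proof -
  define inv where "inv S \<longleftrightarrow> (case S of (U, q) \<Rightarrow> clopen U \<and> x \<in> U \<and> q \<in> U \<and> q \<noteq> x)" for S
  define succ where "succ n S S' \<longleftrightarrow> (case S of (U, q) \<Rightarrow> case S' of (U', q') \<Rightarrow>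
      q \<notin> U' \<and> (\<forall>z\<in>U'. z \<in> U \<and> d x z < 1 / real (Suc n)))"
    for n and S S' :: "'a set \<times> 'a"
  have ex: "\<exists>q. inv (U, q)" if "clopen U" "x \<in> U" for U
  proof -
    have "near x (\<lambda>y. y \<in> U)" using that x by (auto simp: clopen_def)
    then show ?thesis using near_other[of x] that x by (auto simp: inv_def)
  qed
  have "\<exists>S. \<forall>n. (inv (S n) \<and> (n = 0 \<longrightarrow> fst (S n) = M)) \<and> succ n (S n) (S (Suc n))"
  proof (rule dependent_nat_choice)
    \<comment> \<open>Starting from all of \<open>M\<close>, every point other than \<open>x\<close>
      falls into some annulus.\<close>
    have "clopen M" by (auto simp: clopen_def intro: near_mono[OF near_True])
    then show "\<exists>S. inv S \<and> (0 = 0 \<longrightarrow> fst S = M)" using ex[of M] x by auto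
  next
    fix S and n :: nat assume "inv S \<and> (n = 0 \<longrightarrow> fst S = M)"
    then obtain U q where U: "S = (U, q)" "clopen U" "x \<in> U" "q \<in> U" "q \<noteq> x"
      by (auto simp: inv_def split: prod.splits)
    have "near x (\<lambda>y. y \<in> U \<and> (y = q \<longrightarrow> y = x) \<and> d x y < 1 / real (Suc n))"
      using U x by (intro near_conj near_dist near_singleton) (auto simp: clopen_def)
    then obtain U' where U': "clopen U'" "x \<in> U'"
      "\<And>y. y \<in> U' \<Longrightarrow> y \<in> U \<and> (y = q \<longrightarrow> y = x) \<and> d x y < 1 / real (Suc n)"
      using clopen_nbhd[OF x] by blast
    obtain q' where "inv (U', q')" using ex U' by blast
    moreover have "succ n S (U', q')" using U' U by (auto simp: succ_def)
    ultimately show "\<exists>S'. (inv S' \<and> (Suc n = 0 \<longrightarrow> fst S' = M)) \<and> succ n S S'" by blast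
  qed
  then obtain S where S: "\<And>n. inv (S n)" "fst (S 0) = M" "\<And>n. succ n (S n) (S (Suc n))" by blast
  define U where "U n = fst (S n)" for n
  define p where "p n = snd (S n)" for n
  have S_eq: "S n = (U n, p n)" for n by (simp add: U_def p_def)
  have U: "clopen (U n)" "x \<in> U n" "p n \<in> U n" "p n \<noteq> x" for n
    using S(1)[of n] unfolding inv_def S_eq by simp_all
  have step: "p n \<notin> U (Suc n)" "z \<in> U (Suc n) \<Longrightarrow> z \<in> U n" "z \<in> U (Suc n) \<Longrightarrow> d x z < 1 / real (Suc n)" for n z
    using S(3)[of n] unfolding succ_def S_eq by simp_all
  have U_anti: "U n \<subseteq> U m" if "m \<le> n" for m n
    using that by (rule lift_Suc_antimono_le[rotated]) (use step(2) in blast)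
  have U0: "U 0 = M" by (simp add: U_def S)
  have pM: "p n \<in> M" for n using U(1,3)[of n] by (auto simp: clopen_def)
  define h where "h z = (LEAST n. z \<notin> U (Suc n))" for z
  have h_eq: "h z = n" if "z \<in> U n" "z \<notin> U (Suc n)" for z n
    unfolding h_def using that U_anti[of "Suc _" n]
    by (intro Least_equality) (auto simp: not_less_eq_eq[symmetric])
  have h: "z \<in> U (h z)" "z \<notin> U (Suc (h z))" if z: "z \<in> M" "z \<noteq> x" for z
  proof -
    have "d x z > 0" using x z by simp
    then obtain n where "1 / real (Suc n) < d x z" by (rule nat_approx_posE)
    then have "z \<notin> U (Suc n)" using step(3)[of z n] by linarith
    then show "z \<notin> U (Suc (h z))" unfolding h_def by (rule LeastI)
    show "z \<in> U (h z)"
    proof (cases "h z")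
      case (Suc j)
      then have "z \<in> U (Suc j)"
        using not_less_Least[of j "\<lambda>n. z \<notin> U (Suc n)"] unfolding h_def by auto
      then show ?thesis using Suc by simp
    qed (simp add: U0 z)
  qed
  show ?thesis
  proof (intro exI[of _ h] exI[of _ p] conjI ballI allI impI)
    show "locally_const y h" if y: "y \<in> M" "y \<noteq> x" for y
    proof -
      have "near y (\<lambda>z. (z \<in> U (h y)) = (y \<in> U (h y)) \<and> (z \<in> U (Suc (h y))) = (y \<in> U (Suc (h y))))"
        using U(1) y(1) by (intro near_conj) (auto simp: clopen_def)
      then show ?thesis
        by (rule near_mono) (rule h_eq, use h[OF y] in simp_all)
    qed
    show "p n \<in> M" for n by (rule pM)
    show "p n \<noteq> x" for n by (rule U(4))
    show "h (p n) = n" for n using h_eq U(3) step(1) by blast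
    show "\<exists>N. \<forall>n\<ge>N. P (p n)" if "near x P" for P
    proof -
      obtain r where r: "r > 0" "\<forall>y\<in>M. d x y < r \<longrightarrow> P y" using \<open>near x P\<close> by (auto simp: near_def)
      obtain N where N: "1 / real (Suc N) < r" using nat_approx_posE[OF r(1)] by blast
      have "P (p n)" if "n \<ge> Suc N" for n
      proof -
        have "p n \<in> U (Suc N)" using U(3) U_anti[OF that] by blast
        then have "d x (p n) < r" using step(3)[of "p n" N] N by linarith
        then show ?thesis using r(2) pM by blast
      qed
      then show ?thesis by blast
    qed
  qed
qed

lemma disjoint_clopen_nbhds:
  assumes "finite W" "inj_on e W" "e ` W \<subseteq> M"
  obtains U where "\<And>w. w \<in> W \<Longrightarrow> clopen (U w)" "\<And>w. w \<in> W \<Longrightarrow> e w \<in> U w"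
    and "\<And>w w' y. w \<in> W \<Longrightarrow> w' \<in> W \<Longrightarrow> y \<in> U w \<Longrightarrow> y \<in> U w' \<Longrightarrow> w = w'"
proof -
  \<comment> \<open>Half the least distance will be the radius; the 1 keeps the minimum defined when
    there are no two distinct indices.\<close>
  let ?D = "insert 1 ((\<lambda>(w, w'). d (e w) (e w')) ` {(w, w') \<in> W \<times> W. w \<noteq> w'})"
  have fin: "finite ?D" using assms(1) by (auto intro: finite_subset[of _ "W \<times> W"])
  have "\<forall>t\<in>?D. t > 0" using assms(2,3) by (auto simp: inj_on_def image_subset_iff)
  then have pos: "Min ?D > 0" using fin by (simp add: Min_gr_iff)
  have sep: "Min ?D \<le> d (e w) (e w')" if "w \<in> W" "w' \<in> W" "w \<noteq> w'" for w w'
    using fin that by (intro Min_le) auto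
  define \<delta> where "\<delta> = Min ?D"
  have "\<exists>U. clopen U \<and> e w \<in> U \<and> (\<forall>y\<in>U. d (e w) y < \<delta> / 2)" if "w \<in> W" for w
  proof (rule clopen_nbhd)
    show "e w \<in> M" using that assms(3) by blast
    show "near (e w) (\<lambda>y. d (e w) y < \<delta> / 2)" using pos unfolding \<delta>_def by (intro near_dist half_gt_zero)
  qed blast
  then have "\<forall>w\<in>W. \<exists>U. clopen U \<and> e w \<in> U \<and> (\<forall>y\<in>U. d (e w) y < \<delta> / 2)" by blast
  from bchoice[OF this] obtain U where U: "\<And>w. w \<in> W \<Longrightarrow> clopen (U w)" "\<And>w. w \<in> W \<Longrightarrow> e w \<in> U w"
    "\<And>w y. w \<in> W \<Longrightarrow> y \<in> U w \<Longrightarrow> d (e w) y < \<delta> / 2"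
    by blast
  have "w = w'" if *: "w \<in> W" "w' \<in> W" "y \<in> U w" "y \<in> U w'" for w w' y
  proof (rule ccontr)
    assume "w \<noteq> w'"
    have "y \<in> M" using U(1)[OF *(1)] *(3) by (auto simp: clopen_def)
    then have "d (e w) (e w') \<le> d (e w) y + d y (e w')" using * assms(3) by (intro triangle) auto
    then show False
      using U(3)[OF *(1,3)] U(3)[OF *(2,4)] sep[OF *(1,2) \<open>w \<noteq> w'\<close>, folded \<delta>_def] by (simp add: commute)
  qed
  then show thesis using U(1,2) that by blast
qed

text \<open>The first three conjuncts say that the map is continuous, open and onto for the topology
  of upward closed sets; the last two, about the size of fibres, serve the modality
  \<open>DBox\<close>.\<close>

lemma map_onto_DT1S_frame:
  fixes W :: "'w set"
  assumes "M \<noteq> {}" and fin: "finite W" and frame: "DT1S_frame W I R"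
  shows "\<exists>f. (\<forall>x\<in>M. f x \<in> W \<and> near x (\<lambda>y. R (f x) (f y))) \<and>
    (\<forall>x\<in>M. \<forall>v\<in>W. \<forall>r>0. R (f x) v \<longrightarrow> (\<exists>y\<in>M. d x y < r \<and> f y = v)) \<and>
    (\<forall>v\<in>W. \<exists>y\<in>M. f y = v) \<and>
    (\<forall>x\<in>M. \<forall>v\<in>W - I. \<exists>y\<in>M. y \<noteq> x \<and> f y = v) \<and>
    (\<forall>x\<in>M. \<forall>y\<in>M. f x = f y \<longrightarrow> f x \<in> I \<longrightarrow> x = y)"
proof -
  have W: "W \<noteq> {}" "I \<subseteq> W" and R: "reflp R" "transp R"
    and min: "\<And>i w. i \<in> I \<Longrightarrow> w \<in> W \<Longrightarrow> R w i \<Longrightarrow> w = i"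
    and succ: "\<And>i. i \<in> I \<Longrightarrow> \<exists>w\<in>W. w \<noteq> i \<and> R i w"
    using frame by (auto simp: DT1S_frame_def)
  note cW = countable_finite[OF fin]
  \<comment> \<open>The default label for points outside all \<open>U w\<close>. If \<open>I\<close>
    is inhabited, a proper successor of one of its members will do: members of \<open>I\<close> are
    minimal, so it is not among them.\<close>
  obtain w0 where w0: "w0 \<in> W - I"
  proof (cases "I = {}")
    case True then show thesis using W that by blast
  next
    case False
    then obtain i where i: "i \<in> I" by blast
    then obtain w where w: "w \<in> W" "w \<noteq> i" "R i w" using succ by blast
    then have "w \<notin> I" using min i W(2) by blast
    then show thesis using w that by blast
  qed
  obtain x0 where x0: "x0 \<in> M" using \<open>M \<noteq> {}\<close> by blast
  \<comment> \<open>Here \<open>annuli\<close> supplies infinitely many distinct points: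
    \<open>p0\<close> is injective because \<open>h0\<close> is a left inverse.\<close>
  obtain h0 :: "'a \<Rightarrow> nat" and p0 where p0: "\<And>n. p0 n \<in> M" "\<And>n. h0 (p0 n) = n"
    using annuli[OF x0] by blast
  define e where "e w = p0 (to_nat_on W w)" for w
  have inj: "inj_on e W"
    using inj_on_to_nat_on[OF cW] p0(2) unfolding e_def inj_on_def by metis
  have eM: "e w \<in> M" for w by (simp add: e_def p0)
  obtain U where U: "\<And>w. w \<in> W \<Longrightarrow> clopen (U w)" "\<And>w. w \<in> W \<Longrightarrow> e w \<in> U w"
    "\<And>w w' y. w \<in> W \<Longrightarrow> w' \<in> W \<Longrightarrow> y \<in> U w \<Longrightarrow> y \<in> U w' \<Longrightarrow> w = w'"
    using disjoint_clopen_nbhds[OF fin inj] eM by (metis image_subsetI)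
  have "\<forall>w. \<exists>h p. (\<forall>y\<in>M. y \<noteq> e w \<longrightarrow> locally_const y h) \<and>
      (\<forall>n::nat. p n \<in> M \<and> p n \<noteq> e w \<and> h (p n) = n) \<and>
      (\<forall>P. near (e w) P \<longrightarrow> (\<exists>N. \<forall>n\<ge>N. P (p n)))"
    by (intro allI annuli eM)
  from choice[OF this] obtain h where "\<forall>w. \<exists>p. (\<forall>y\<in>M. y \<noteq> e w \<longrightarrow> locally_const y (h w)) \<and>
      (\<forall>n::nat. p n \<in> M \<and> p n \<noteq> e w \<and> (h w) (p n) = n) \<and>
      (\<forall>P. near (e w) P \<longrightarrow> (\<exists>N. \<forall>n\<ge>N. P (p n)))"
    by (rule exE)
  from choice[OF this] obtain p where hp: "\<forall>w. (\<forall>y\<in>M. y \<noteq> e w \<longrightarrow> locally_const y (h w)) \<and>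
      (\<forall>n::nat. p w n \<in> M \<and> p w n \<noteq> e w \<and> (h w) (p w n) = n) \<and>
      (\<forall>P. near (e w) P \<longrightarrow> (\<exists>N. \<forall>n\<ge>N. P (p w n)))"
    by (rule exE)
  have h: "locally_const y (h w)" if "y \<in> M" "y \<noteq> e w" for w y
    using spec[OF hp, of w] that by simp
  have p: "p w n \<in> M" "p w n \<noteq> e w" "h w (p w n) = n" for w n
    using spec[OF hp, of w] by simp_all
  have p_near: "\<exists>N. \<forall>n\<ge>N. P (p w n)" if "near (e w) P" for w P
    using spec[OF hp, of w] that by simp
  have "\<exists>s :: nat \<Rightarrow> 'w. (\<forall>n. s n \<in> W - {i} \<and> R i (s n)) \<and>
      (\<forall>w N. w \<in> W - {i} \<longrightarrow> R i w \<longrightarrow> (\<exists>n\<ge>N. s n = w))" if i: "i \<in> I" for i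
  proof -
    have "countable {w \<in> W - {i}. R i w}" "{w \<in> W - {i}. R i w} \<noteq> {}"
      using cW succ[OF i] by (auto intro: countable_subset[OF _ cW])
    then show ?thesis
    proof (rule enumerate_infinitely_often)
      fix s :: "nat \<Rightarrow> 'w"
      assume "\<And>n. s n \<in> {w \<in> W - {i}. R i w}"
        and "\<And>a N. a \<in> {w \<in> W - {i}. R i w} \<Longrightarrow> \<exists>n\<ge>N. s n = a"
      then show ?thesis by (intro exI[of _ s]) simp
    qed
  qed
  then obtain s :: "'w \<Rightarrow> nat \<Rightarrow> 'w" where
    s: "\<And>i n. i \<in> I \<Longrightarrow> s i n \<in> W - {i} \<and> R i (s i n)"
    "\<And>i w N. i \<in> I \<Longrightarrow> w \<in> W - {i} \<Longrightarrow> R i w \<Longrightarrow> \<exists>n\<ge>N. s i n = w"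
    by metis
  have U_near: "near x (\<lambda>y. (y \<in> U w) = (x \<in> U w))" if "w \<in> W" "x \<in> M" for w x
    using U(1)[OF that(1)] that(2) by (auto simp: clopen_def)
  define m where "m y = {w \<in> W. y \<in> U w}" for y
  have m_eq: "m y = {w}" if "w \<in> W" "y \<in> U w" for y w using U(3) that by (auto simp: m_def)
  have m_lc: "locally_const x m" if x: "x \<in> M" for x
  proof -
    have "near x (\<lambda>y. \<forall>w\<in>W. (y \<in> U w) = (x \<in> U w))"
      using x fin by (intro near_finite U_near)
    then show ?thesis by (rule near_mono) (auto simp: m_def)
  qed
  define g0 where "g0 y = (if m y = {} then w0 else
      (let w = the_elem (m y) in if w \<in> I then s w (h w y) else w))" for y
  have g0_I: "g0 y = s i (h i y)" if "i \<in> I" "y \<in> U i" for i y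
    using that m_eq[of i y] W(2) by (auto simp: g0_def)
  have g0_W: "g0 y = w" if "w \<in> W - I" "y \<in> U w" for w y
    using that m_eq[of w y] by (auto simp: g0_def)
  have g0_0: "g0 y = w0" if "m y = {}" for y using that by (simp add: g0_def)
  have m_cases: "m y = {} \<or> (\<exists>i\<in>I. y \<in> U i) \<or> (\<exists>w\<in>W - I. y \<in> U w)" for y
    by (auto simp: m_def)
  have s_notI: "s i n \<notin> I" if "i \<in> I" for i n using s(1)[OF that, of n] min[of "s i n" i] that W(2) by auto
  \<comment> \<open>The initial labels avoid \<open>I\<close>. As they only rise and members of
    \<open>I\<close> are minimal, \<open>f\<close> will avoid \<open>I\<close> outside
    \<open>K\<close> too.\<close>
  have g0: "g0 y \<in> W - I" for y
    using m_cases[of y] g0_0 g0_I g0_W w0 s(1) s_notI by (metis DiffD1 DiffI)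
  define K where "K = e ` I"
  \<comment> \<open>Fixed in advance are the points \<open>e w\<close>, which make the map onto, and
    the \<open>p i n\<close>, which keep their annulus labels, so that each proper successor of
    \<open>i\<close> occurs arbitrarily close to \<open>e i\<close>.\<close>
  define E0 where "E0 = e ` W \<union> {p i n | i n. i \<in> I \<and> p i n \<in> U i}"
  have K_U: "y = e i" if "y \<in> K" "i \<in> I" "y \<in> U i" for y i
  proof -
    obtain j where "j \<in> I" "y = e j" using \<open>y \<in> K\<close> by (auto simp: K_def)
    then show ?thesis using U(2,3)[of j] U(3)[of j i y] that W(2) by auto
  qed
  have lc: "locally_const x g0" if x: "x \<in> M - K" for x
    using m_cases[of x]
  proof (elim disjE bexE)
    assume "m x = {}"
    then show ?thesis using m_lc[of x] x by (auto simp: g0_0 elim!: near_mono)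
  next
    fix i assume i: "i \<in> I" "x \<in> U i"
    then have "x \<noteq> e i" using x by (auto simp: K_def)
    have "near x (\<lambda>y. (y \<in> U i) = (x \<in> U i) \<and> h i y = h i x)"
      using i x \<open>x \<noteq> e i\<close> W(2) by (intro near_conj U_near h) auto
    then show ?thesis by (rule near_mono) (simp add: g0_I[OF i(1)] i(2))
  next
    fix w assume w: "w \<in> W - I" "x \<in> U w"
    have "near x (\<lambda>y. (y \<in> U w) = (x \<in> U w))"
      using w x by (intro U_near) auto
    then show ?thesis by (rule near_mono) (simp add: g0_W[OF w(1)] w(2))
  qed
  have disc: "discrete_at x E0" if x: "x \<in> M - K" for x
    unfolding E0_def
  proof (rule discrete_at_Un)
    have "near x (\<lambda>y. \<forall>w\<in>W. y = e w \<longrightarrow> y = x)"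
      using x fin by (intro near_finite near_singleton) auto
    then show "discrete_at x (e ` W)" by (rule near_mono) auto
    show "discrete_at x {p i n |i n. i \<in> I \<and> p i n \<in> U i}"
    proof (cases "\<exists>i\<in>I. x \<in> U i")
      case True
      then obtain i where i: "i \<in> I" "x \<in> U i" by blast
      then have "x \<noteq> e i" using x by (auto simp: K_def)
      \<comment> \<open>Near \<open>x\<close> only its own annulus matters, and the only chosen
        point there can be \<open>p i (h i x)\<close>.\<close>
      have "near x (\<lambda>y. (y \<in> U i) = (x \<in> U i) \<and> h i y = h i x \<and> (y = p i (h i x) \<longrightarrow> y = x))"
        using i x \<open>x \<noteq> e i\<close> W(2) by (intro near_conj near_singleton U_near h) auto
      then show ?thesis
      proof (rule near_mono, intro impI)
        fix y assume y: "(y \<in> U i) = (x \<in> U i) \<and> h i y = h i x \<and> (y = p i (h i x) \<longrightarrow> y = x)"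
          and "y \<in> {p i n |i n. i \<in> I \<and> p i n \<in> U i}"
        then obtain j n where "y = p j n" "j \<in> I" "y \<in> U j" by blast
        moreover from this have "j = i" using U(3)[of j i y] y i W(2) by blast
        ultimately show "y = x" using y p(3)[of i n] by simp
      qed
    next
      case False
      have "locally_const x m" using m_lc x by blast
      then show ?thesis
      proof (rule near_mono, intro impI)
        fix y assume "m y = m x" and "y \<in> {p i n |i n. i \<in> I \<and> p i n \<in> U i}"
        then obtain i where "i \<in> I" "y \<in> U i" by blast
        then have "i \<in> m x" using \<open>m y = m x\<close> W(2) by (auto simp: m_def)
        then show "y = x" using False \<open>i \<in> I\<close> by (auto simp: m_def)
      qed
    qed
  qed
  have KE: "K \<subseteq> E0" "E0 \<subseteq> M" using W(2) eM p(1) by (auto simp: K_def E0_def)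
  have "\<forall>x\<in>M - K. locally_const x g0" "\<forall>x\<in>M - K. g0 x \<in> W" "\<forall>x\<in>M - K. discrete_at x E0"
    using lc g0 disc by blast+
  note ex = interior_map[OF fin W(1) R this(1,2) KE this(3)]
  from ex obtain f where f: "\<forall>x\<in>M - K. f x \<in> W \<and> R (g0 x) (f x)"
    "\<forall>x\<in>M - K. near x (\<lambda>y. y \<notin> K \<and> R (f x) (f y))"
    "\<forall>x\<in>M - K. \<forall>v\<in>W. \<forall>r>0. R (f x) v \<longrightarrow> (\<exists>y\<in>M - E0. d x y < r \<and> f y = v)"
    "\<forall>x\<in>E0 - K. f x = g0 x"
    by (elim exE conjE) (rule that)
  define F where "F x = (if x \<in> K then inv_into I e x else f x)" for x
  have FK: "F (e i) = i" if "i \<in> I" for i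
    using that inj_on_subset[OF inj W(2)] by (simp add: F_def K_def)
  have Ff: "F x = f x" if "x \<notin> K" for x using that by (simp add: F_def)
  have f_notI: "f x \<notin> I" if "x \<in> M - K" for x
    using bspec[OF f(1) that] min[of "f x" "g0 x"] g0[of x] by auto
  have cases: "x \<in> M - K \<or> (\<exists>i\<in>I. x = e i)" if "x \<in> M" for x using that by (auto simp: K_def)
  have 1: "F x \<in> W \<and> near x (\<lambda>y. R (F x) (F y))" if x: "x \<in> M" for x
    using cases[OF x]
  proof (elim disjE bexE)
    assume x: "x \<in> M - K"
    then show ?thesis using bspec[OF f(1) x] bspec[OF f(2) x] by (auto simp: Ff elim!: near_mono)
  next
    fix i assume i: "i \<in> I" "x = e i"
    have "near x (\<lambda>y. (y \<in> U i) = (x \<in> U i))"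
      using i x W(2) by (intro U_near) auto
    then have "near x (\<lambda>y. R i (F y))"
    proof (rule near_mono)
      fix y assume y: "y \<in> M" "(y \<in> U i) = (x \<in> U i)"
      then have yU: "y \<in> U i" using U(2) i W(2) by blast
      show "R i (F y)"
      proof (cases "y = e i")
        case True then show ?thesis using FK[OF i(1)] reflpD[OF R(1)] by simp
      next
        case False
        then have "y \<in> M - K" using K_U yU i(1) y(1) by blast
        then have "R (g0 y) (F y)" using f(1) Ff by auto
        moreover have "R i (g0 y)" using g0_I[OF i(1) yU] s(1)[OF i(1)] by simp
        ultimately show ?thesis using transpD[OF R(2)] by blast
      qed
    qed
    then show ?thesis using i FK W(2) by auto
  qed
  have 2: "\<exists>y\<in>M. d x y < r \<and> F y = v" if x: "x \<in> M" and v: "v \<in> W" "R (F x) v" and r: "r > 0" for x v r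
    using cases[OF x]
  proof (elim disjE bexE)
    assume x: "x \<in> M - K"
    then obtain y where "y \<in> M - E0" "d x y < r" "f y = v"
      using bspec[OF bspec[OF f(3) x] v(1)] v(2) r Ff by auto
    then show ?thesis using Ff[of y] KE by blast
  next
    fix i assume i: "i \<in> I" "x = e i"
    show ?thesis
    proof (cases "v = i")
      case True then show ?thesis using i x r FK by (intro bexI[of _ x]) auto
    next
      case False
      have "near x (\<lambda>y. (y \<in> U i) = (x \<in> U i) \<and> d x y < r)"
        using i x W(2) r by (intro near_conj near_dist U_near) auto
      then obtain N where N: "\<forall>n\<ge>N. (p i n \<in> U i) = (x \<in> U i) \<and> d x (p i n) < r"
        using p_near[of i] i(2) by blast
      obtain n where n: "n \<ge> N" "s i n = v" using s(2)[OF i(1), of v N] v False i FK by auto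
      have pU: "p i n \<in> U i" "d x (p i n) < r" using N n U(2) i W(2) by auto
      then have "p i n \<in> E0 - K" using K_U[OF _ i(1)] p(2) i(1) by (auto simp: E0_def)
      then have "F (p i n) = v" using f(4) Ff g0_I[OF i(1) pU(1)] p(3) n(2) by simp
      then show ?thesis using pU p(1) by blast
    qed
  qed
  have f_e: "F (e w) = w" if "w \<in> W" for w
  proof (cases "w \<in> I")
    case False
    then have "e w \<in> E0 - K" using that inj W(2) by (auto simp: E0_def K_def inj_on_def)
    then show ?thesis using f(4) Ff g0_W[of w "e w"] U(2) that False by simp
  qed (rule FK)
  have 4: "\<exists>y\<in>M. y \<noteq> x \<and> F y = v" if v: "v \<in> W - I" for x v
  proof -
    have e: "e v \<in> M - K" "e v \<in> E0" using v inj W(2) eM by (auto simp: E0_def K_def inj_on_def)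
    have "R (f (e v)) v" using f_e[of v] v Ff[of "e v"] e reflpD[OF R(1)] by auto
    \<comment> \<open>By reflexivity \<open>v\<close> occurs again near \<open>e v\<close>, at a
      point outside \<open>E0\<close> and so other than \<open>e v\<close>. One of the two differs
      from \<open>x\<close>.\<close>
    then obtain y where "y \<in> M - E0" "f y = v"
      using bspec[OF bspec[OF f(3) e(1)], of v] v zero_less_one[where 'a = real] by blast
    then have "y \<in> M" "F y = v" "y \<noteq> e v" using Ff[of y] KE e by auto
    then show ?thesis using e f_e[of v] v by (metis DiffD1)
  qed
  have 5: "x = y" if "x \<in> M" "y \<in> M" "F x = F y" "F x \<in> I" for x y
  proof -
    have "\<exists>i\<in>I. z = e i" if "z \<in> M" "F z \<in> I" for z
      using cases[OF that(1)] f_notI Ff that(2) by auto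
    then obtain i j where "i \<in> I" "x = e i" "j \<in> I" "y = e j" using \<open>x \<in> M\<close> \<open>y \<in> M\<close> \<open>F x = F y\<close> \<open>F x \<in> I\<close> by metis
    then show ?thesis using FK \<open>F x = F y\<close> by simp
  qed
  have 3: "\<exists>y\<in>M. F y = v" if "v \<in> W" for v using f_e[OF that] eM by blast
  show ?thesis
    by (intro exI[of _ F] conjI ballI allI impI) (use 1 2 3 4 5 in \<open>simp; fail\<close>)+
qed

section \<open>Transfer of truth from the finite model to the space\<close>

lemma sat_Box_near:
  assumes "x \<in> M"
  shows "sat mtopology \<theta> x (Box A) \<longleftrightarrow> near x (\<lambda>y. sat mtopology \<theta> y A)"
proof
  assume "sat mtopology \<theta> x (Box A)"
  then obtain U where U: "openin mtopology U" "x \<in> U" "\<forall>y\<in>U. sat mtopology \<theta> y A"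
    unfolding sat_Box_openin by blast
  then obtain r where "r > 0" "mball x r \<subseteq> U" by (auto simp: openin_mtopology)
  then show "near x (\<lambda>y. sat mtopology \<theta> y A)"
    using U(3) assms unfolding near_def by (intro exI[of _ r]) auto
next
  assume "near x (\<lambda>y. sat mtopology \<theta> y A)"
  then obtain r where "r > 0" "\<forall>y\<in>M. d x y < r \<longrightarrow> sat mtopology \<theta> y A" by (auto simp: near_def)
  then show "sat mtopology \<theta> x (Box A)"
    unfolding sat_Box_openin using assms by (intro exI[of _ "mball x r"]) auto
qed

lemma not_valid_if_type_model:
  assumes "M \<noteq> {}" "finite W" "DT1S_frame W I R" and model: "type_model (subformulas A) W I R"
    and T: "T \<in> W" "A \<notin> T"
  shows "\<not> valid_in mtopology A"
proof
  assume valid: "valid_in mtopology A"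
  obtain f where
    f: "\<forall>x\<in>M. f x \<in> W \<and> near x (\<lambda>y. R (f x) (f y))"
    "\<forall>x\<in>M. \<forall>v\<in>W. \<forall>r>0. R (f x) v \<longrightarrow> (\<exists>y\<in>M. d x y < r \<and> f y = v)"
    "\<forall>v\<in>W. \<exists>y\<in>M. f y = v"
    "\<forall>x\<in>M. \<forall>v\<in>W - I. \<exists>y\<in>M. y \<noteq> x \<and> f y = v"
    "\<forall>x\<in>M. \<forall>y\<in>M. f x = f y \<longrightarrow> f x \<in> I \<longrightarrow> x = y"
    using map_onto_DT1S_frame[OF assms(1-3)] by (elim exE conjE) (rule that)
  define \<theta> where "\<theta> n = {x \<in> M. Var n \<in> f x}" for n
  \<comment> \<open>The truth lemma. For \<open>Box\<close>, continuity gives that membership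
    implies truth and openness the converse; for \<open>DBox\<close>, the former uses the singleton
    fibres over \<open>I\<close>, the latter surjectivity and a second point in the other
    fibres.\<close>
  have *: "sat mtopology \<theta> x B \<longleftrightarrow> B \<in> f x" if "B \<in> subformulas A" "x \<in> M" for B x
    using that
  proof (induction B arbitrary: x)
    case (Var n)
    then show ?case by (simp add: \<theta>_def)
  next
    case Bot
    then show ?case using model f(1) by (simp add: type_model_def)
  next
    case (Imp B C)
    then have "B \<in> subformulas A" "C \<in> subformulas A" by (blast intro: subformulas_closed)+
    then show ?case using Imp model f(1) by (simp add: type_model_def)
  next
    case (Box B)
    then have IH: "\<And>y. y \<in> M \<Longrightarrow> sat mtopology \<theta> y B \<longleftrightarrow> B \<in> f y"
      by (blast intro: subformulas_closed)
    have "Box B \<in> f x \<longleftrightarrow> (\<forall>v\<in>W. R (f x) v \<longrightarrow> B \<in> v)"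
      using Box model f(1) by (simp add: type_model_def)
    also have "\<dots> \<longleftrightarrow> near x (\<lambda>y. sat mtopology \<theta> y B)"
    proof
      assume all: "\<forall>v\<in>W. R (f x) v \<longrightarrow> B \<in> v"
      have "near x (\<lambda>y. R (f x) (f y))" using f(1) Box.prems by blast
      then show "near x (\<lambda>y. sat mtopology \<theta> y B)"
        by (rule near_mono) (use all f(1) IH in simp)
    next
      assume "near x (\<lambda>y. sat mtopology \<theta> y B)"
      then obtain r where r: "r > 0" "\<forall>y\<in>M. d x y < r \<longrightarrow> sat mtopology \<theta> y B"
        by (auto simp: near_def)
      show "\<forall>v\<in>W. R (f x) v \<longrightarrow> B \<in> v"
      proof (intro ballI impI)
        fix v assume "v \<in> W" "R (f x) v"
        then obtain y where "y \<in> M" "d x y < r" "f y = v" using f(2) Box.prems r(1) by blast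
        then show "B \<in> v" using r(2) IH by blast
      qed
    qed
    finally show ?case using sat_Box_near[OF Box.prems(2)] by simp
  next
    case (DBox B)
    then have IH: "\<And>y. y \<in> M \<Longrightarrow> sat mtopology \<theta> y B \<longleftrightarrow> B \<in> f y"
      by (blast intro: subformulas_closed)
    have "DBox B \<in> f x \<longleftrightarrow> (\<forall>v\<in>W. v \<noteq> f x \<or> f x \<notin> I \<longrightarrow> B \<in> v)"
      using DBox model f(1) by (simp add: type_model_def)
    also have "\<dots> \<longleftrightarrow> (\<forall>y\<in>M. y \<noteq> x \<longrightarrow> B \<in> f y)"
    proof
      assume all: "\<forall>v\<in>W. v \<noteq> f x \<or> f x \<notin> I \<longrightarrow> B \<in> v"
      show "\<forall>y\<in>M. y \<noteq> x \<longrightarrow> B \<in> f y"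
      proof (intro ballI impI)
        fix y assume "y \<in> M" "y \<noteq> x"
        then have "f y \<noteq> f x \<or> f x \<notin> I" using f(5) DBox.prems(2) by metis
        then show "B \<in> f y" using all f(1) \<open>y \<in> M\<close> by blast
      qed
    next
      assume all: "\<forall>y\<in>M. y \<noteq> x \<longrightarrow> B \<in> f y"
      show "\<forall>v\<in>W. v \<noteq> f x \<or> f x \<notin> I \<longrightarrow> B \<in> v"
      proof (intro ballI impI)
        fix v assume v: "v \<in> W" "v \<noteq> f x \<or> f x \<notin> I"
        have "\<exists>y\<in>M. y \<noteq> x \<and> f y = v"
        proof (cases "v = f x")
          case True
          then show ?thesis using f(4) v DBox.prems(2) by blast
        next
          case False
          then show ?thesis using f(3) v(1) by metis
        qed
        then show "B \<in> v" using all by blast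
      qed
    qed
    finally show ?case using IH by simp
  qed
  obtain x where "x \<in> M" "f x = T" using f(3) T(1) by blast
  moreover have "\<forall>n. \<theta> n \<subseteq> topspace mtopology" by (auto simp: \<theta>_def)
  ultimately show False
    using valid *[OF subformulas_self] T(2) unfolding valid_in_def by auto
qed

end

section \<open>The topological hypotheses in metric form, and completeness\<close>

lemma zero_dim_metricI:
  assumes "Metric_space M d"
    and zd: "zero_dimensional (Metric_space.mtopology M d)"
    and di: "dense_in_itself (Metric_space.mtopology M d)"
  shows "zero_dim_metric M d"
proof -
  interpret Metric_space M d by fact
  show ?thesis
  proof
    fix x and r :: real assume x: "x \<in> M" "r > 0"
    show "\<exists>y\<in>M. y \<noteq> x \<and> d x y < r"
    proof (rule ccontr)
      assume "\<not> (\<exists>y\<in>M. y \<noteq> x \<and> d x y < r)"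
      then have "mball x r = {x}" using x by auto
      then have "openin mtopology {x}" by (metis openin_mball)
      then show False using di x by (auto simp: dense_in_itself_def)
    qed
    have "(arbitrary union_of (\<lambda>U. openin mtopology U \<and> closedin mtopology U)) (mball x r)"
      using zd openin_mball unfolding zero_dimensional_def by metis
    then obtain \<U> where \<U>: "\<U> \<subseteq> Collect (\<lambda>U. openin mtopology U \<and> closedin mtopology U)"
      "\<Union>\<U> = mball x r"
      unfolding union_of_def by (elim exE conjE) (rule that)
    have "x \<in> \<Union>\<U>" using x \<U>(2) by simp
    then obtain U where "U \<in> \<U>" "x \<in> U" by (rule UnionE)
    then show "\<exists>U. openin mtopology U \<and> closedin mtopology U \<and> x \<in> U \<and> U \<subseteq> mball x r"
      using \<U> by (intro exI[of _ U]) auto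
  qed
qed

theorem theorem6p11:
  fixes M :: "'a set" and d :: "'a \<Rightarrow> 'a \<Rightarrow> real" and A :: form
  assumes "Metric_space M d"
    and "zero_dimensional (Metric_space.mtopology M d)"
    and "dense_in_itself (Metric_space.mtopology M d)"
  shows "A \<in> S4DT1S \<longleftrightarrow> valid_in (Metric_space.mtopology M d) A"
proof -
  interpret zero_dim_metric M d using assms by (rule zero_dim_metricI)
  have "M \<noteq> {}" using assms(2) by (simp add: zero_dimensional_def)
  show ?thesis
  proof
    assume "A \<in> S4DT1S"
    then show "valid_in mtopology A"
      using S4DT1S_sound[OF Hausdorff_imp_t1_space[OF Hausdorff_space_mtopology] assms(3)] by blast
  next
    assume "valid_in mtopology A"
    show "A \<in> S4DT1S"
    proof (rule ccontr)
      assume "A \<notin> S4DT1S"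
      with logic_S4DT1S S4DT1S_axioms_subset
      obtain W I R T where "finite W" "DT1S_frame W I R" "type_model (subformulas A) W I R"
        "T \<in> W" "A \<notin> T"
        by (rule finite_model_property)
      from not_valid_if_type_model[OF \<open>M \<noteq> {}\<close> this] \<open>valid_in mtopology A\<close> show False by blast
    qed
  qed
qed

end
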